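(* Let $R$ be a commutative ring with unit, $\mathcal{A}$ a homologically connective dg category over $R$, and $(\mathcal{A}_n)_{n\geq 0}$ a Postnikov tower for $\mathcal{A}$. Then the natural dg functor $$\mathcal{A}\longrightarrow\underset{n}{\mathrm{holim}}\,\mathcal{A}_n$$ is a quasi-equivalence.
   Context: Complexes are complexes of $R$-modules with homological grading. $\mathrm{dgcat}$ is the category of small dg categories over $R$, with the Quillen model structure whose weak equivalences are the quasi-equivalences (dg functors $F$ with all $F(x,y)$ quasi-isomorphisms and $\mathsf{H}_0(F)$ an equivalence of categories) and whose fibrations are the dg functors $F:\mathcal{A}\to\mathcal{B}$ such that (F1) all $F(x,y)$ are degreewise surjective and (F2) for every object $a_1\in\mathcal{A}$ and every morphism $v\in\mathcal{B}(F(a_1),b)$ that becomes invertible in $\mathsf{H}_0(\mathcal{B})$ there is a morphism $u\in\mathcal{A}(a_1,a_2)$ with $F(u)=v$ that becomes invertible in $\mathsf{H}_0(\mathcal{A})$. The homotopy limit (of the tower $\cdots\to\mathcal{A}_1\to\mathcal{A}_0$) is taken in this model category. A small dg category $\mathcal{A}$ is homologically connective if $\mathsf{H}_i(\mathcal{A}(x,y))=0$ for all objects $x,y$ and all $i<0$; it is positively graded if $\mathcal{A}(x,y)_i=0$ for all $x,y$ and all $i<0$. $\tau_{\geq 0}(\mathcal{A})$ denotes the positively graded dg category with the same objects obtained by applying the intelligent truncation (degree $0$ cycles in degree $0$, unchanged in degrees $>0$, zero in degrees $<0$) to each complex of morphisms; for homologically connective $\mathcal{A}$ the natural dg functor $\tau_{\geq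 0}(\mathcal{A})\to\mathcal{A}$ is a quasi-equivalence. A Postnikov tower $(\mathcal{A}_n)_{n\geq 0}$ for a positively graded dg category $\mathcal{A}$ is a commutative diagram in $\mathrm{dgcat}$ consisting of dg functors $\cdots\to\mathcal{A}_2\to\mathcal{A}_1\to\mathcal{A}_0$ and dg functors $P_n:\mathcal{A}\to\mathcal{A}_n$ ($n\ge 0$) compatible with them, such that for all $n\geq 0$: (A1) for all objects $x,y\in\mathcal{A}$ the induced map $\mathsf{H}_i(\mathcal{A}(x,y))\to\mathsf{H}_i(\mathcal{A}_n(P_nx,P_ny))$ is an isomorphism for $i\leq n$; (A2) $P_n$ induces an equivalence of categories $\mathsf{H}_0(\mathcal{A})\to\mathsf{H}_0(\mathcal{A}_n)$; (B) for all objects $x,y\in\mathcal{A}_n$, $\mathsf{H}_i(\mathcal{A}_n(x,y))=0$ for $i>n$. For a homologically connective $\mathcal{A}$, a Postnikov tower for $\mathcal{A}$ means a Postnikov tower for $\tau_{\geq 0}(\mathcal{A})$; accordingly, the natural map is then the one $\tau_{\geq 0}(\mathcal{A})\to\mathrm{holim}_n\,\mathcal{A}_n$ induced by the $P_n$, with $\mathcal{A}$ identified with $\tau_{\geq 0}(\mathcal{A})$ via the quasi-equivalence $\tau_{\geq 0}(\mathcal{A})\to\mathcal{A}$. *)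

theory Defs
  imports "HOL-Algebra.AbelCoset" "HOL-Algebra.Module"
begin

section \<open>Small categories and equivalences\<close>

record ('o, 'a) cat =
  cOb :: "'o set"
  cHom :: "'o \<Rightarrow> 'o \<Rightarrow> 'a set"
  cComp :: "'o \<Rightarrow> 'o \<Rightarrow> 'o \<Rightarrow> 'a \<Rightarrow> 'a \<Rightarrow> 'a"
  cId :: "'o \<Rightarrow> 'a"

text \<open>Hom-sets of different pairs of objects need not be disjoint, so composition is indexed
  by objects: \<open>cComp C x y z g f\<close> is \<open>g \<circ> f\<close> for \<open>f : x \<rightarrow> y\<close> and \<open>g : y \<rightarrow> z\<close>.\<close>

locale small_category =
  fixes C :: "('o, 'a) cat"
  assumes id_closed: "x \<in> cOb C \<Longrightarrow> cId C x \<in> cHom C x x"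
    and comp_closed:
      "\<lbrakk>x \<in> cOb C; y \<in> cOb C; z \<in> cOb C; f \<in> cHom C x y; g \<in> cHom C y z\<rbrakk>
        \<Longrightarrow> cComp C x y z g f \<in> cHom C x z"
    and id_left: "\<lbrakk>x \<in> cOb C; y \<in> cOb C; f \<in> cHom C x y\<rbrakk> \<Longrightarrow> cComp C x y y (cId C y) f = f"
    and id_right: "\<lbrakk>x \<in> cOb C; y \<in> cOb C; f \<in> cHom C x y\<rbrakk> \<Longrightarrow> cComp C x x y f (cId C x) = f"
    and comp_assoc:
      "\<lbrakk>w \<in> cOb C; x \<in> cOb C; y \<in> cOb C; z \<in> cOb C;
        f \<in> cHom C w x; g \<in> cHom C x y; h \<in> cHom C y z\<rbrakk>
        \<Longrightarrow> cComp C w x z (cComp C x y z h g) f = cComp C w y z h (cComp C w x y g f)"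

definition cat_iso :: "('o, 'a) cat \<Rightarrow> 'o \<Rightarrow> 'o \<Rightarrow> 'a \<Rightarrow> bool" where
  "cat_iso C x y f \<longleftrightarrow> f \<in> cHom C x y \<and>
    (\<exists>g \<in> cHom C y x. cComp C x y x g f = cId C x \<and> cComp C y x y f g = cId C y)"

record ('o, 'a, 'p, 'b) cat_fun =
  cfOb :: "'o \<Rightarrow> 'p"
  cfHom :: "'o \<Rightarrow> 'o \<Rightarrow> 'a \<Rightarrow> 'b"

locale cat_functor = C: small_category C + D: small_category D
  for C :: "('o, 'a) cat" and D :: "('p, 'b) cat" +
  fixes F :: "('o, 'a, 'p, 'b) cat_fun"
  assumes ob_closed: "x \<in> cOb C \<Longrightarrow> cfOb F x \<in> cOb D"
    and hom_closed:
      "\<lbrakk>x \<in> cOb C; y \<in> cOb C; f \<in> cHom C x y\<rbrakk> \<Longrightarrow> cfHom F x y f \<in> cHom D (cfOb F x) (cfOb F y)"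
    and map_id: "x \<in> cOb C \<Longrightarrow> cfHom F x x (cId C x) = cId D (cfOb F x)"
    and map_comp:
      "\<lbrakk>x \<in> cOb C; y \<in> cOb C; z \<in> cOb C; f \<in> cHom C x y; g \<in> cHom C y z\<rbrakk>
        \<Longrightarrow> cfHom F x z (cComp C x y z g f)
          = cComp D (cfOb F x) (cfOb F y) (cfOb F z) (cfHom F y z g) (cfHom F x y f)"

definition cat_fun_id :: "('o, 'a, 'o, 'a) cat_fun" where
  "cat_fun_id = \<lparr>cfOb = (\<lambda>x. x), cfHom = (\<lambda>_ _ f. f)\<rparr>"

definition cat_fun_comp ::
    "('p, 'b, 'q, 'c) cat_fun \<Rightarrow> ('o, 'a, 'p, 'b) cat_fun \<Rightarrow> ('o, 'a, 'q, 'c) cat_fun" where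
  "cat_fun_comp G F = \<lparr>cfOb = (\<lambda>x. cfOb G (cfOb F x)),
    cfHom = (\<lambda>x y f. cfHom G (cfOb F x) (cfOb F y) (cfHom F x y f))\<rparr>"

definition naturally_isomorphic ::
    "('o, 'a) cat \<Rightarrow> ('p, 'b) cat \<Rightarrow> ('o, 'a, 'p, 'b) cat_fun \<Rightarrow> ('o, 'a, 'p, 'b) cat_fun \<Rightarrow> bool" where
  "naturally_isomorphic C D F G \<longleftrightarrow>
    (\<exists>t. (\<forall>x \<in> cOb C. cat_iso D (cfOb F x) (cfOb G x) (t x)) \<and>
      (\<forall>x \<in> cOb C. \<forall>y \<in> cOb C. \<forall>f \<in> cHom C x y.
        cComp D (cfOb F x) (cfOb F y) (cfOb G y) (t y) (cfHom F x y f) =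
        cComp D (cfOb F x) (cfOb G x) (cfOb G y) (cfHom G x y f) (t x)))"

definition cat_equivalence ::
    "('o, 'a) cat \<Rightarrow> ('p, 'b) cat \<Rightarrow> ('o, 'a, 'p, 'b) cat_fun \<Rightarrow> bool" where
  "cat_equivalence C D F \<longleftrightarrow> cat_functor C D F \<and>
    (\<exists>G. cat_functor D C G \<and>
      naturally_isomorphic C C cat_fun_id (cat_fun_comp G F) \<and>
      naturally_isomorphic D D (cat_fun_comp F G) cat_fun_id)"


section \<open>Small dg categories\<close>

definition linear_maps ::
    "('r, 's) ring_scheme \<Rightarrow> ('r, 'a, 't) module_scheme \<Rightarrow> ('r, 'b, 'u) module_scheme \<Rightarrow> ('a \<Rightarrow> 'b) set"
  where "linear_maps R M N =
    {h \<in> carrier M \<rightarrow> carrier N.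
      (\<forall>x \<in> carrier M. \<forall>y \<in> carrier M. h (x \<oplus>\<^bsub>M\<^esub> y) = h x \<oplus>\<^bsub>N\<^esub> h y) \<and>
      (\<forall>a \<in> carrier R. \<forall>x \<in> carrier M. h (a \<odot>\<^bsub>M\<^esub> x) = a \<odot>\<^bsub>N\<^esub> h x)}"

definition koszul :: "('r, 'a, 't) module_scheme \<Rightarrow> int \<Rightarrow> 'a \<Rightarrow> 'a" where
  "koszul M i x = (if even i then x else \<ominus>\<^bsub>M\<^esub> x)"

text \<open>\<open>dgHom A x y i\<close> is the degree \<open>i\<close> part of the complex of morphisms from \<open>x\<close> to \<open>y\<close>;
  the multiplicative fields of these \<open>module\<close> records carry no meaning.
  \<open>dgDiff A x y i\<close> is the differential from degree \<open>i\<close> to degree \<open>i - 1\<close>, and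
  \<open>dgComp A x y z i j g f\<close> is \<open>g \<circ> f\<close> for \<open>g\<close> in \<open>dgHom A y z i\<close> and \<open>f\<close> in \<open>dgHom A x y j\<close>.\<close>

record ('r, 'o, 'm) dgcat =
  dgOb :: "'o set"
  dgHom :: "'o \<Rightarrow> 'o \<Rightarrow> int \<Rightarrow> ('r, 'm) module"
  dgDiff :: "'o \<Rightarrow> 'o \<Rightarrow> int \<Rightarrow> 'm \<Rightarrow> 'm"
  dgComp :: "'o \<Rightarrow> 'o \<Rightarrow> 'o \<Rightarrow> int \<Rightarrow> int \<Rightarrow> 'm \<Rightarrow> 'm \<Rightarrow> 'm"
  dgId :: "'o \<Rightarrow> 'm"

locale dg_category = R: cring R
  for R :: "('r, 's) ring_scheme" (structure) +
  fixes A :: "('r, 'o, 'm) dgcat"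
  assumes hom_module: "\<lbrakk>x \<in> dgOb A; y \<in> dgOb A\<rbrakk> \<Longrightarrow> module R (dgHom A x y i)"
    and diff_linear:
      "\<lbrakk>x \<in> dgOb A; y \<in> dgOb A\<rbrakk>
        \<Longrightarrow> dgDiff A x y i \<in> linear_maps R (dgHom A x y i) (dgHom A x y (i - 1))"
    and diff_diff:
      "\<lbrakk>x \<in> dgOb A; y \<in> dgOb A; f \<in> carrier (dgHom A x y i)\<rbrakk>
        \<Longrightarrow> dgDiff A x y (i - 1) (dgDiff A x y i f) = \<zero>\<^bsub>dgHom A x y (i - 1 - 1)\<^esub>"
    and comp_linear_right:
      "\<lbrakk>x \<in> dgOb A; y \<in> dgOb A; z \<in> dgOb A; g \<in> carrier (dgHom A y z i)\<rbrakk>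
        \<Longrightarrow> (\<lambda>f. dgComp A x y z i j g f) \<in> linear_maps R (dgHom A x y j) (dgHom A x z (i + j))"
    and comp_linear_left:
      "\<lbrakk>x \<in> dgOb A; y \<in> dgOb A; z \<in> dgOb A; f \<in> carrier (dgHom A x y j)\<rbrakk>
        \<Longrightarrow> (\<lambda>g. dgComp A x y z i j g f) \<in> linear_maps R (dgHom A y z i) (dgHom A x z (i + j))"
    and leibniz:
      "\<lbrakk>x \<in> dgOb A; y \<in> dgOb A; z \<in> dgOb A;
        g \<in> carrier (dgHom A y z i); f \<in> carrier (dgHom A x y j)\<rbrakk>
        \<Longrightarrow> dgDiff A x z (i + j) (dgComp A x y z i j g f) =
          dgComp A x y z (i - 1) j (dgDiff A y z i g) f \<oplus>\<^bsub>dgHom A x z (i + j - 1)\<^esub>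
          koszul (dgHom A x z (i + j - 1)) i (dgComp A x y z i (j - 1) g (dgDiff A x y j f))"
    and id_closed: "x \<in> dgOb A \<Longrightarrow> dgId A x \<in> carrier (dgHom A x x 0)"
    and id_cycle: "x \<in> dgOb A \<Longrightarrow> dgDiff A x x 0 (dgId A x) = \<zero>\<^bsub>dgHom A x x (-1)\<^esub>"
    and id_left:
      "\<lbrakk>x \<in> dgOb A; y \<in> dgOb A; f \<in> carrier (dgHom A x y i)\<rbrakk>
        \<Longrightarrow> dgComp A x y y 0 i (dgId A y) f = f"
    and id_right:
      "\<lbrakk>x \<in> dgOb A; y \<in> dgOb A; f \<in> carrier (dgHom A x y i)\<rbrakk>
        \<Longrightarrow> dgComp A x x y i 0 f (dgId A x) = f"
    and comp_assoc:
      "\<lbrakk>w \<in> dgOb A; x \<in> dgOb A; y \<in> dgOb A; z \<in> dgOb A; h \<in> carrier (dgHom A y z i);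
        g \<in> carrier (dgHom A x y j); f \<in> carrier (dgHom A w x k)\<rbrakk>
        \<Longrightarrow> dgComp A w x z (i + j) k (dgComp A x y z i j h g) f =
          dgComp A w y z i (j + k) h (dgComp A w x y j k g f)"

record ('o, 'm, 'p, 'n) dgfun =
  dgfOb :: "'o \<Rightarrow> 'p"
  dgfHom :: "'o \<Rightarrow> 'o \<Rightarrow> int \<Rightarrow> 'm \<Rightarrow> 'n"

locale dg_functor = A: dg_category R A + B: dg_category R B
  for R :: "('r, 's) ring_scheme" (structure)
    and A :: "('r, 'o, 'm) dgcat" and B :: "('r, 'p, 'n) dgcat" +
  fixes F :: "('o, 'm, 'p, 'n) dgfun"
  assumes ob_closed: "x \<in> dgOb A \<Longrightarrow> dgfOb F x \<in> dgOb B"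
    and hom_linear:
      "\<lbrakk>x \<in> dgOb A; y \<in> dgOb A\<rbrakk>
        \<Longrightarrow> dgfHom F x y i \<in> linear_maps R (dgHom A x y i) (dgHom B (dgfOb F x) (dgfOb F y) i)"
    and map_diff:
      "\<lbrakk>x \<in> dgOb A; y \<in> dgOb A; f \<in> carrier (dgHom A x y i)\<rbrakk>
        \<Longrightarrow> dgfHom F x y (i - 1) (dgDiff A x y i f) =
          dgDiff B (dgfOb F x) (dgfOb F y) i (dgfHom F x y i f)"
    and map_id: "x \<in> dgOb A \<Longrightarrow> dgfHom F x x 0 (dgId A x) = dgId B (dgfOb F x)"
    and map_comp:
      "\<lbrakk>x \<in> dgOb A; y \<in> dgOb A; z \<in> dgOb A;
        g \<in> carrier (dgHom A y z i); f \<in> carrier (dgHom A x y j)\<rbrakk>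
        \<Longrightarrow> dgfHom F x z (i + j) (dgComp A x y z i j g f) =
          dgComp B (dgfOb F x) (dgfOb F y) (dgfOb F z) i j (dgfHom F y z i g) (dgfHom F x y j f)"

definition dgfun_comp ::
    "('p, 'n, 'q, 'k) dgfun \<Rightarrow> ('o, 'm, 'p, 'n) dgfun \<Rightarrow> ('o, 'm, 'q, 'k) dgfun" where
  "dgfun_comp G F = \<lparr>dgfOb = (\<lambda>x. dgfOb G (dgfOb F x)),
    dgfHom = (\<lambda>x y i f. dgfHom G (dgfOb F x) (dgfOb F y) i (dgfHom F x y i f))\<rparr>"

text \<open>Equality of dg functors on \<open>A\<close>, disregarding values outside the carriers of \<open>A\<close>.\<close>

definition dgfun_eq_on ::
    "('r, 'o, 'm) dgcat \<Rightarrow> ('o, 'm, 'p, 'n) dgfun \<Rightarrow> ('o, 'm, 'p, 'n) dgfun \<Rightarrow> bool" where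
  "dgfun_eq_on A F G \<longleftrightarrow>
    (\<forall>x \<in> dgOb A. dgfOb F x = dgfOb G x) \<and>
    (\<forall>x \<in> dgOb A. \<forall>y \<in> dgOb A. \<forall>i. \<forall>f \<in> carrier (dgHom A x y i).
      dgfHom F x y i f = dgfHom G x y i f)"


section \<open>Homology\<close>

definition cycles :: "('r, 'o, 'm) dgcat \<Rightarrow> 'o \<Rightarrow> 'o \<Rightarrow> int \<Rightarrow> 'm set" where
  "cycles A x y i = {f \<in> carrier (dgHom A x y i). dgDiff A x y i f = \<zero>\<^bsub>dgHom A x y (i - 1)\<^esub>}"

definition boundaries :: "('r, 'o, 'm) dgcat \<Rightarrow> 'o \<Rightarrow> 'o \<Rightarrow> int \<Rightarrow> 'm set" where
  "boundaries A x y i = dgDiff A x y (i + 1) ` carrier (dgHom A x y (i + 1))"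

text \<open>The homology \<open>H\<^sub>i(A(x,y))\<close>, as the library's quotient of the additive group of cycles.
  The library quotient does not record the induced \<open>R\<close>-action. This does not matter below: only
  vanishing and bijectivity of maps induced by \<open>R\<close>-linear chain maps are at issue, and such an
  induced map is an isomorphism of groups iff it is an isomorphism of \<open>R\<close>-modules.\<close>

definition homology :: "('r, 'o, 'm) dgcat \<Rightarrow> 'o \<Rightarrow> 'o \<Rightarrow> int \<Rightarrow> 'm set monoid" where
  "homology A x y i = dgHom A x y i \<lparr>carrier := cycles A x y i\<rparr> A_Mod boundaries A x y i"

definition homology_class :: "('r, 'o, 'm) dgcat \<Rightarrow> 'o \<Rightarrow> 'o \<Rightarrow> int \<Rightarrow> 'm \<Rightarrow> 'm set" where
  "homology_class A x y i f = boundaries A x y i +>\<^bsub>dgHom A x y i\<^esub> f"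

definition homology_zero :: "('r, 'o, 'm) dgcat \<Rightarrow> 'o \<Rightarrow> 'o \<Rightarrow> int \<Rightarrow> bool" where
  "homology_zero A x y i \<longleftrightarrow> carrier (homology A x y i) = {\<one>\<^bsub>homology A x y i\<^esub>}"

text \<open>The map induced on homology classes: all representatives \<open>f\<close> of a class \<open>X\<close> yield the same
  class, so the union below is that class. The same device is used for composition in \<open>H0\<close>.\<close>

definition homology_map ::
    "('r, 'p, 'n) dgcat \<Rightarrow> ('o, 'm, 'p, 'n) dgfun \<Rightarrow> 'o \<Rightarrow> 'o \<Rightarrow> int \<Rightarrow> 'm set \<Rightarrow> 'n set" where
  "homology_map B F x y i X =
    (\<Union>f\<in>X. homology_class B (dgfOb F x) (dgfOb F y) i (dgfHom F x y i f))"

definition homology_iso ::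
    "('r, 'o, 'm) dgcat \<Rightarrow> ('r, 'p, 'n) dgcat \<Rightarrow> ('o, 'm, 'p, 'n) dgfun \<Rightarrow> 'o \<Rightarrow> 'o \<Rightarrow> int \<Rightarrow> bool" where
  "homology_iso A B F x y i \<longleftrightarrow>
    homology_map B F x y i \<in> iso (homology A x y i) (homology B (dgfOb F x) (dgfOb F y) i)"

definition H0 :: "('r, 'o, 'm) dgcat \<Rightarrow> ('o, 'm set) cat" where
  "H0 A = \<lparr>cOb = dgOb A,
    cHom = (\<lambda>x y. carrier (homology A x y 0)),
    cComp = (\<lambda>x y z Y X. \<Union>g\<in>Y. \<Union>f\<in>X. homology_class A x z 0 (dgComp A x y z 0 0 g f)),
    cId = (\<lambda>x. homology_class A x x 0 (dgId A x))\<rparr>"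

definition H0_fun ::
    "('r, 'p, 'n) dgcat \<Rightarrow> ('o, 'm, 'p, 'n) dgfun \<Rightarrow> ('o, 'm set, 'p, 'n set) cat_fun" where
  "H0_fun B F = \<lparr>cfOb = dgfOb F, cfHom = (\<lambda>x y. homology_map B F x y 0)\<rparr>"

text \<open>A morphism (degree \<open>0\<close> cycle) that becomes invertible in \<open>H0\<close>.\<close>

definition H0_invertible :: "('r, 'o, 'm) dgcat \<Rightarrow> 'o \<Rightarrow> 'o \<Rightarrow> 'm \<Rightarrow> bool" where
  "H0_invertible A x y f \<longleftrightarrow> f \<in> cycles A x y 0 \<and> cat_iso (H0 A) x y (homology_class A x y 0 f)"


section \<open>Quasi-equivalences and fibrations\<close>

definition quasi_equivalence ::
    "('r, 's) ring_scheme \<Rightarrow> ('r, 'o, 'm) dgcat \<Rightarrow> ('r, 'p, 'n) dgcat \<Rightarrow> ('o, 'm, 'p, 'n) dgfun \<Rightarrow> bool"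
  where "quasi_equivalence R A B F \<longleftrightarrow> dg_functor R A B F \<and>
    (\<forall>x \<in> dgOb A. \<forall>y \<in> dgOb A. \<forall>i. homology_iso A B F x y i) \<and>
    cat_equivalence (H0 A) (H0 B) (H0_fun B F)"

definition dg_fibration ::
    "('r, 's) ring_scheme \<Rightarrow> ('r, 'o, 'm) dgcat \<Rightarrow> ('r, 'p, 'n) dgcat \<Rightarrow> ('o, 'm, 'p, 'n) dgfun \<Rightarrow> bool"
  where "dg_fibration R A B F \<longleftrightarrow> dg_functor R A B F \<and>
    (\<forall>x \<in> dgOb A. \<forall>y \<in> dgOb A. \<forall>i.
      dgfHom F x y i ` carrier (dgHom A x y i) = carrier (dgHom B (dgfOb F x) (dgfOb F y) i)) \<and>
    (\<forall>a1 \<in> dgOb A. \<forall>b \<in> dgOb B. \<forall>v. H0_invertible B (dgfOb F a1) b v \<longrightarrow>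
      (\<exists>a2 \<in> dgOb A. dgfOb F a2 = b \<and> (\<exists>u. H0_invertible A a1 a2 u \<and> dgfHom F a1 a2 0 u = v)))"

definition terminal_dgcat :: "('r, unit, unit) dgcat" where
  "terminal_dgcat = \<lparr>dgOb = UNIV,
    dgHom = (\<lambda>_ _ _. \<lparr>carrier = UNIV, monoid.mult = (\<lambda>_ _. ()), one = (), zero = (),
      add = (\<lambda>_ _. ()), smult = (\<lambda>_ _. ())\<rparr>),
    dgDiff = (\<lambda>_ _ _ _. ()),
    dgComp = (\<lambda>_ _ _ _ _ _ _. ()),
    dgId = (\<lambda>_. ())\<rparr>"

definition dg_fibrant :: "('r, 's) ring_scheme \<Rightarrow> ('r, 'o, 'm) dgcat \<Rightarrow> bool" where
  "dg_fibrant R A \<longleftrightarrow>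
    dg_fibration R A terminal_dgcat \<lparr>dgfOb = (\<lambda>_. ()), dgfHom = (\<lambda>_ _ _ _. ())\<rparr>"


section \<open>Towers, limits and homotopy limits\<close>

text \<open>\<open>p n\<close> is the transition functor from \<open>T (n + 1)\<close> to \<open>T n\<close>.\<close>

locale dg_tower =
  fixes R :: "('r, 's) ring_scheme"
    and T :: "nat \<Rightarrow> ('r, 'o, 'm) dgcat"
    and p :: "nat \<Rightarrow> ('o, 'm, 'o, 'm) dgfun"
  assumes tower_cat: "dg_category R (T n)"
    and tower_fun: "dg_functor R (T (Suc n)) (T n) (p n)"

text \<open>The strict limit of a tower in \<open>dgcat\<close>, with compatible sequences as objects and
  compatible sequences of morphisms with termwise operations as morphisms.\<close>

definition tower_lim ::
    "(nat \<Rightarrow> ('r, 'o, 'm) dgcat) \<Rightarrow> (nat \<Rightarrow> ('o, 'm, 'o, 'm) dgfun)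
      \<Rightarrow> ('r, nat \<Rightarrow> 'o, nat \<Rightarrow> 'm) dgcat" where
  "tower_lim T p = \<lparr>
    dgOb = {x. \<forall>n. x n \<in> dgOb (T n) \<and> dgfOb (p n) (x (Suc n)) = x n},
    dgHom = (\<lambda>x y i. \<lparr>
      carrier = {f. \<forall>n. f n \<in> carrier (dgHom (T n) (x n) (y n) i) \<and>
        dgfHom (p n) (x (Suc n)) (y (Suc n)) i (f (Suc n)) = f n},
      monoid.mult = (\<lambda>f g n. f n \<otimes>\<^bsub>dgHom (T n) (x n) (y n) i\<^esub> g n),
      one = (\<lambda>n. \<one>\<^bsub>dgHom (T n) (x n) (y n) i\<^esub>),
      zero = (\<lambda>n. \<zero>\<^bsub>dgHom (T n) (x n) (y n) i\<^esub>),
      add = (\<lambda>f g n. f n \<oplus>\<^bsub>dgHom (T n) (x n) (y n) i\<^esub> g n),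
      smult = (\<lambda>a f n. a \<odot>\<^bsub>dgHom (T n) (x n) (y n) i\<^esub> f n)\<rparr>),
    dgDiff = (\<lambda>x y i f n. dgDiff (T n) (x n) (y n) i (f n)),
    dgComp = (\<lambda>x y z i j g f n. dgComp (T n) (x n) (y n) (z n) i j (g n) (f n)),
    dgId = (\<lambda>x n. dgId (T n) (x n))\<rparr>"

text \<open>The functor into the strict limit induced by a compatible family \<open>P\<close>.\<close>

definition tower_lim_fun ::
    "(nat \<Rightarrow> ('o, 'm, 'p, 'n) dgfun) \<Rightarrow> ('o, 'm, nat \<Rightarrow> 'p, nat \<Rightarrow> 'n) dgfun" where
  "tower_lim_fun P =
    \<lparr>dgfOb = (\<lambda>x n. dgfOb (P n) x), dgfHom = (\<lambda>x y i f n. dgfHom (P n) x y i f)\<rparr>"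

text \<open>Fibrant replacement \<open>\<eta> : (T, p) \<rightarrow> (T', p')\<close> of a tower: \<open>\<eta>\<close> is a natural levelwise
  quasi-equivalence, and \<open>(T', p')\<close> is fibrant for the Reedy (= injective) model structure on
  towers, i.e. \<open>T' 0\<close> is fibrant and all \<open>p' n\<close> are fibrations. The homotopy limit of \<open>(T, p)\<close>
  is \<open>tower_lim T' p'\<close>, and a compatible family of dg functors \<open>P n : A \<rightarrow> T n\<close> induces
  \<open>tower_lim_fun (\<lambda>n. dgfun_comp (\<eta> n) (P n)) : A \<rightarrow> tower_lim T' p'\<close>. Since it is only defined up
  to the choice of a replacement, assertions about it are to be made for every replacement.\<close>

definition fibrant_replacement ::
    "('r, 's) ring_scheme
      \<Rightarrow> (nat \<Rightarrow> ('r, 'o, 'm) dgcat) \<Rightarrow> (nat \<Rightarrow> ('o, 'm, 'o, 'm) dgfun)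
      \<Rightarrow> (nat \<Rightarrow> ('r, 'p, 'n) dgcat) \<Rightarrow> (nat \<Rightarrow> ('p, 'n, 'p, 'n) dgfun)
      \<Rightarrow> (nat \<Rightarrow> ('o, 'm, 'p, 'n) dgfun) \<Rightarrow> bool" where
  "fibrant_replacement R T p T' p' \<eta> \<longleftrightarrow>
    dg_tower R T p \<and> dg_tower R T' p' \<and>
    (\<forall>n. quasi_equivalence R (T n) (T' n) (\<eta> n)) \<and>
    (\<forall>n. dgfun_eq_on (T (Suc n))
      (dgfun_comp (p' n) (\<eta> (Suc n))) (dgfun_comp (\<eta> n) (p n))) \<and>
    dg_fibrant R (T' 0) \<and>
    (\<forall>n. dg_fibration R (T' (Suc n)) (T' n) (p' n))"


section \<open>Connectivity, truncation and Postnikov towers\<close>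

definition homologically_connective :: "('r, 'o, 'm) dgcat \<Rightarrow> bool" where
  "homologically_connective A \<longleftrightarrow>
    (\<forall>x \<in> dgOb A. \<forall>y \<in> dgOb A. \<forall>i < 0. homology_zero A x y i)"

definition positively_graded :: "('r, 'o, 'm) dgcat \<Rightarrow> bool" where
  "positively_graded A \<longleftrightarrow>
    (\<forall>x \<in> dgOb A. \<forall>y \<in> dgOb A. \<forall>i < 0. carrier (dgHom A x y i) = {\<zero>\<^bsub>dgHom A x y i\<^esub>})"

definition truncation :: "('r, 'o, 'm) dgcat \<Rightarrow> ('r, 'o, 'm) dgcat" where
  "truncation A = A\<lparr>dgHom := (\<lambda>x y i. dgHom A x y i \<lparr>carrier :=
    (if i < 0 then {\<zero>\<^bsub>dgHom A x y i\<^esub>}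
     else if i = 0 then cycles A x y 0
     else carrier (dgHom A x y i))\<rparr>)\<rparr>"

definition postnikov_tower ::
    "('r, 's) ring_scheme \<Rightarrow> ('r, 'o, 'm) dgcat
      \<Rightarrow> (nat \<Rightarrow> ('r, 'p, 'n) dgcat) \<Rightarrow> (nat \<Rightarrow> ('p, 'n, 'p, 'n) dgfun)
      \<Rightarrow> (nat \<Rightarrow> ('o, 'm, 'p, 'n) dgfun) \<Rightarrow> bool" where
  "postnikov_tower R A T p P \<longleftrightarrow>
    dg_category R A \<and> positively_graded A \<and> dg_tower R T p \<and>
    (\<forall>n. dg_functor R A (T n) (P n)) \<and>
    (\<forall>n. dgfun_eq_on A (dgfun_comp (p n) (P (Suc n))) (P n)) \<and>
    (\<forall>n. \<forall>x \<in> dgOb A. \<forall>y \<in> dgOb A. \<forall>i \<le> int n. homology_iso A (T n) (P n) x y i) \<and>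
    (\<forall>n. cat_equivalence (H0 A) (H0 (T n)) (H0_fun (T n) (P n))) \<and>
    (\<forall>n. \<forall>x \<in> dgOb (T n). \<forall>y \<in> dgOb (T n). \<forall>i > int n. homology_zero (T n) x y i)"

end

theory Submission
  imports Defs
begin

text \<open>Let \<open>B\<close> be the truncation of \<open>A\<close> and \<open>Q n : B \<rightarrow> T' n\<close> the composite of \<open>P n\<close> and \<open>\<eta> n\<close>. It
  is bijective on homology in degrees \<open>\<le> n\<close> and essentially surjective on \<open>H0\<close>, so by two out of
  three the fibration \<open>p' n\<close> is bijective on homology in degrees \<open>\<le> n\<close>, for all objects of
  \<open>T' (n + 1)\<close> and not only for those coming from \<open>B\<close>. Since \<open>p' n\<close> is surjective, cycles and bounding
  chains of degree \<open>\<le> n\<close> can be lifted strictly along it, so the projection from the limit to \<open>T' N\<close> is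
  bijective on \<open>H\<^sub>i\<close> for \<open>i < N\<close>. Composed with \<open>B \<rightarrow> lim T'\<close> this projection is \<open>Q N\<close>, and two out of
  three gives bijectivity on homology (take \<open>N > i\<close>) and essential surjectivity on \<open>H0\<close> (take
  \<open>N = 1\<close>).\<close>

text \<open>An object of the limit is a strictly compatible sequence, while objects of
  \<open>B\<close> reach each stage only up to isomorphism in \<open>H0\<close>, with choices at
  different stages that need not match. Isomorphisms are therefore not lifted along the tower: the
  projection to one stage is fully faithful on \<open>H0\<close>, and an isomorphism found at that
  stage comes back to the limit. The same mismatch is why \<open>p' n\<close> has to be controlled
  at arbitrary objects; conjugation by cycles that are invertible in \<open>H0\<close> moves the
  statement there from the image of \<open>B\<close>. The bound \<open>i < N\<close> comes from
  injectivity: two cycles of degree \<open>i\<close> are compared by a bounding chain of degree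
  \<open>i + 1\<close>, and correcting a lift of that chain uses surjectivity on homology in degree
  \<open>i + 1\<close>, available at the stages \<open>n \<ge> i + 1\<close>. This is the place
  where a derived limit could otherwise appear.\<close>

section \<open>Fully faithful functors\<close>

lemma cat_iso_comp:
  assumes "small_category C" "x \<in> cOb C" "y \<in> cOb C" "z \<in> cOb C"
    and "cat_iso C x y f" "cat_iso C y z g"
  shows "cat_iso C x z (cComp C x y z g f)"
proof -
  interpret small_category C by fact
  obtain f' where f: "f \<in> cHom C x y" "f' \<in> cHom C y x"
      "cComp C x y x f' f = cId C x" "cComp C y x y f f' = cId C y"
    using assms(5) unfolding cat_iso_def by auto
  obtain g' where g: "g \<in> cHom C y z" "g' \<in> cHom C z y"
      "cComp C y z y g' g = cId C y" "cComp C z y z g g' = cId C z"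
    using assms(6) unfolding cat_iso_def by auto
  have gf: "cComp C x y z g f \<in> cHom C x z" and fg: "cComp C z y x f' g' \<in> cHom C z x"
    using assms f g by (auto intro: comp_closed)
  have "cComp C x z x (cComp C z y x f' g') (cComp C x y z g f)
      = cComp C x y x f' (cComp C x z y g' (cComp C x y z g f))"
    using assms f g gf by (simp add: comp_assoc)
  also have "cComp C x z y g' (cComp C x y z g f) = f"
    using assms f g by (simp add: comp_assoc[symmetric] id_left)
  finally have 1: "cComp C x z x (cComp C z y x f' g') (cComp C x y z g f) = cId C x"
    using f by simp
  have "cComp C z x z (cComp C x y z g f) (cComp C z y x f' g')
      = cComp C z y z g (cComp C z x y f (cComp C z y x f' g'))"
    using assms f g fg by (simp add: comp_assoc)
  also have "cComp C z x y f (cComp C z y x f' g') = g'"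
    using assms f g by (simp add: comp_assoc[symmetric] id_left)
  finally have 2: "cComp C z x z (cComp C x y z g f) (cComp C z y x f' g') = cId C z"
    using g by simp
  show ?thesis unfolding cat_iso_def using gf fg 1 2 by blast
qed

lemma (in cat_functor) cat_iso_map:
  assumes "x \<in> cOb C" "y \<in> cOb C" "cat_iso C x y f"
  shows "cat_iso D (cfOb F x) (cfOb F y) (cfHom F x y f)"
proof -
  obtain g where g: "f \<in> cHom C x y" "g \<in> cHom C y x"
      "cComp C x y x g f = cId C x" "cComp C y x y f g = cId C y"
    using assms unfolding cat_iso_def by auto
  then show ?thesis
    unfolding cat_iso_def
    using assms hom_closed map_comp[of x y x f g] map_comp[of y x y g f] map_id by fastforce
qed

text \<open>\<open>cat_equivalence\<close> asks for a functor in the other direction and two natural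
  isomorphisms. For functors on \<open>H0\<close> the accessible data are bijectivity on hom-sets
  and essential surjectivity; this locale leads from these to an equivalence.\<close>

locale fully_faithful_functor = cat_functor C D F
  for C :: "('o, 'a) cat" and D :: "('p, 'b) cat" and F :: "('o, 'a, 'p, 'b) cat_fun" +
  assumes hom_bij:
    "\<lbrakk>x \<in> cOb C; y \<in> cOb C\<rbrakk> \<Longrightarrow> bij_betw (cfHom F x y) (cHom C x y) (cHom D (cfOb F x) (cfOb F y))"
begin

lemma hom_inj:
  assumes "x \<in> cOb C" "y \<in> cOb C" "f \<in> cHom C x y" "g \<in> cHom C x y"
    and "cfHom F x y f = cfHom F x y g"
  shows "f = g"
  using hom_bij[of x y] assms by (auto simp: bij_betw_def inj_on_def)

definition preimage :: "'o \<Rightarrow> 'o \<Rightarrow> 'b \<Rightarrow> 'a" where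
  "preimage x y = inv_into (cHom C x y) (cfHom F x y)"

lemma preimage:
  assumes "x \<in> cOb C" "y \<in> cOb C" "f \<in> cHom D (cfOb F x) (cfOb F y)"
  shows "preimage x y f \<in> cHom C x y" and "cfHom F x y (preimage x y f) = f"
proof -
  have "f \<in> cfHom F x y ` cHom C x y"
    using hom_bij assms by (auto simp: bij_betw_def)
  then show "preimage x y f \<in> cHom C x y" and "cfHom F x y (preimage x y f) = f"
    unfolding preimage_def by (auto intro: inv_into_into f_inv_into_f)
qed

text \<open>Faithfulness lifts the two inverse laws: the composites of the preimages have the same
  images as the identities. An isomorphism between images thus comes from one between the objects
  themselves.\<close>

lemma preimage_iso:
  assumes "x \<in> cOb C" "y \<in> cOb C" "cat_iso D (cfOb F x) (cfOb F y) f"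
  shows "cat_iso C x y (preimage x y f)"
proof -
  obtain g where g: "f \<in> cHom D (cfOb F x) (cfOb F y)" "g \<in> cHom D (cfOb F y) (cfOb F x)"
      "cComp D (cfOb F x) (cfOb F y) (cfOb F x) g f = cId D (cfOb F x)"
      "cComp D (cfOb F y) (cfOb F x) (cfOb F y) f g = cId D (cfOb F y)"
    using assms unfolding cat_iso_def by auto
  note pf = preimage[OF assms(1,2) g(1)] and pg = preimage[OF assms(2,1) g(2)]
  have "cComp C x y x (preimage y x g) (preimage x y f) = cId C x"
    using assms pf pg g by (intro hom_inj[of x x]) (auto simp: map_comp map_id intro: C.comp_closed C.id_closed)
  moreover have "cComp C y x y (preimage x y f) (preimage y x g) = cId C y"
    using assms pf pg g by (intro hom_inj[of y y]) (auto simp: map_comp map_id intro: C.comp_closed C.id_closed)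
  ultimately show ?thesis
    unfolding cat_iso_def using pf pg by blast
qed

text \<open>The quasi-inverse is made by choice: \<open>g d\<close> is an object with an isomorphism
  \<open>t d\<close> from \<open>F (g d)\<close> to \<open>d\<close>, \<open>s d\<close> is its
  inverse, and an arrow goes to the preimage of its conjugate. Then \<open>t\<close> itself is the
  counit.\<close>

lemma equivalence:
  assumes ess_surj: "\<And>d. d \<in> cOb D \<Longrightarrow> \<exists>c \<in> cOb C. \<exists>f. cat_iso D (cfOb F c) d f"
  shows "cat_equivalence C D F"
proof -
  obtain g t where gt: "\<And>d. d \<in> cOb D \<Longrightarrow> g d \<in> cOb C \<and> cat_iso D (cfOb F (g d)) d (t d)"
    using ess_surj by metis
  then have g: "\<And>d. d \<in> cOb D \<Longrightarrow> g d \<in> cOb C" by blast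
  have "\<exists>s. \<forall>d\<in>cOb D. s d \<in> cHom D d (cfOb F (g d)) \<and>
      cComp D (cfOb F (g d)) d (cfOb F (g d)) (s d) (t d) = cId D (cfOb F (g d)) \<and>
      cComp D d (cfOb F (g d)) d (t d) (s d) = cId D d"
    using gt unfolding cat_iso_def by (intro bchoice) blast
  then obtain s where
    s: "\<And>d. d \<in> cOb D \<Longrightarrow> s d \<in> cHom D d (cfOb F (g d))"
    and st: "\<And>d. d \<in> cOb D \<Longrightarrow>
      cComp D (cfOb F (g d)) d (cfOb F (g d)) (s d) (t d) = cId D (cfOb F (g d))"
    and ts: "\<And>d. d \<in> cOb D \<Longrightarrow> cComp D d (cfOb F (g d)) d (t d) (s d) = cId D d"
    by blast
  have t: "\<And>d. d \<in> cOb D \<Longrightarrow> t d \<in> cHom D (cfOb F (g d)) d"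
    using gt unfolding cat_iso_def by blast
  have Fg: "\<And>d. d \<in> cOb D \<Longrightarrow> cfOb F (g d) \<in> cOb D"
    using g ob_closed by blast
  \<comment> \<open>For \<open>f\<close> from \<open>d\<close> to \<open>e\<close> this is
    \<open>s e\<close> after \<open>f\<close> after \<open>t d\<close>, the arrow that
    \<open>F\<close> has to hit.\<close>
  define conj where "conj d e f = cComp D (cfOb F (g d)) e (cfOb F (g e)) (s e)
      (cComp D (cfOb F (g d)) d e f (t d))" for d e f
  have conj_closed: "conj d e f \<in> cHom D (cfOb F (g d)) (cfOb F (g e))"
    if "d \<in> cOb D" "e \<in> cOb D" "f \<in> cHom D d e" for d e f
    unfolding conj_def using that s t Fg by (auto intro!: D.comp_closed)
  \<comment> \<open>Naturality of \<open>t\<close>, used both for the composition law of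
    \<open>G\<close> and for the counit.\<close>
  have t_conj: "cComp D (cfOb F (g d)) (cfOb F (g e)) e (t e) (conj d e f)
      = cComp D (cfOb F (g d)) d e f (t d)"
    if "d \<in> cOb D" "e \<in> cOb D" "f \<in> cHom D d e" for d e f
    unfolding conj_def using that s t Fg
    by (simp add: D.comp_assoc[symmetric] ts D.comp_closed D.id_left)
  have t_cancel: "a = b"
    if "d \<in> cOb D" "x \<in> cOb D" "a \<in> cHom D x (cfOb F (g d))" "b \<in> cHom D x (cfOb F (g d))"
      and eq: "cComp D x (cfOb F (g d)) d (t d) a = cComp D x (cfOb F (g d)) d (t d) b" for d x a b
  proof -
    have "a = cComp D x d (cfOb F (g d)) (s d) (cComp D x (cfOb F (g d)) d (t d) a)"
      using that(1-4) s t Fg by (simp add: D.comp_assoc[symmetric] st D.id_left)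
    also have "\<dots> = b"
      unfolding eq using that(1-4) s t Fg by (simp add: D.comp_assoc[symmetric] st D.id_left)
    finally show ?thesis .
  qed
  define G :: "('p, 'b, 'o, 'a) cat_fun"
    where "G = \<lparr>cfOb = g, cfHom = (\<lambda>d e f. preimage (g d) (g e) (conj d e f))\<rparr>"
  have G_ob: "cfOb G = g" by (simp add: G_def)
  have G_hom: "cfHom G d e f \<in> cHom C (g d) (g e)"
      "cfHom F (g d) (g e) (cfHom G d e f) = conj d e f"
    if "d \<in> cOb D" "e \<in> cOb D" "f \<in> cHom D d e" for d e f
    using that preimage[OF g g conj_closed] by (auto simp: G_def)
  have G: "cat_functor D C G"
  proof (unfold_locales, goal_cases)
    case 1 then show ?case by (simp add: G_ob g)
  next
    case 2 then show ?case by (simp add: G_ob G_hom)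
  next
    case (3 x)
    have "conj x x (cId D x) = cId D (cfOb F (g x))"
      unfolding conj_def using 3 t s Fg by (simp add: D.id_left st)
    then show ?case
      unfolding G_ob using 3 G_hom D.id_closed g
      by (intro hom_inj[of "g x" "g x"]) (auto simp: map_id C.id_closed)
  next
    case (4 x y z f h)
    have hf: "cComp D x y z h f \<in> cHom D x z" using 4 by (rule D.comp_closed)
    have "conj x z (cComp D x y z h f)
        = cComp D (cfOb F (g x)) (cfOb F (g y)) (cfOb F (g z)) (conj y z h) (conj x y f)"
    \<comment> \<open>\<open>t z\<close> is monic, and after composing with it both sides become
      \<open>h\<close> after \<open>f\<close> after \<open>t x\<close>.\<close>
    proof (rule t_cancel[of z "cfOb F (g x)"])
      have "cComp D (cfOb F (g x)) (cfOb F (g z)) z (t z)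
          (cComp D (cfOb F (g x)) (cfOb F (g y)) (cfOb F (g z)) (conj y z h) (conj x y f))
        = cComp D (cfOb F (g x)) (cfOb F (g y)) z
            (cComp D (cfOb F (g y)) (cfOb F (g z)) z (t z) (conj y z h)) (conj x y f)"
        using 4 t Fg conj_closed by (simp add: D.comp_assoc)
      also have "\<dots> = cComp D (cfOb F (g x)) y z h
          (cComp D (cfOb F (g x)) (cfOb F (g y)) y (t y) (conj x y f))"
        using 4 t Fg conj_closed by (simp add: t_conj D.comp_assoc)
      also have "\<dots> = cComp D (cfOb F (g x)) x z (cComp D x y z h f) (t x)"
        using 4 t Fg by (simp add: t_conj D.comp_assoc)
      finally show "cComp D (cfOb F (g x)) (cfOb F (g z)) z (t z) (conj x z (cComp D x y z h f))
        = cComp D (cfOb F (g x)) (cfOb F (g z)) z (t z)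
          (cComp D (cfOb F (g x)) (cfOb F (g y)) (cfOb F (g z)) (conj y z h) (conj x y f))"
        using 4 hf by (simp add: t_conj)
    qed (use 4 hf Fg conj_closed in \<open>auto intro!: D.comp_closed\<close>)
    then show ?case
      unfolding G_ob using 4 hf G_hom g
      by (intro hom_inj[of "g x" "g z"]) (auto simp: map_comp C.comp_closed)
  qed
  have "naturally_isomorphic D D (cat_fun_comp F G) cat_fun_id"
    unfolding naturally_isomorphic_def
    using gt by (intro exI[of _ t]) (auto simp: cat_fun_comp_def cat_fun_id_def G_ob G_hom t_conj)
  moreover have "naturally_isomorphic C C cat_fun_id (cat_fun_comp G F)"
    unfolding naturally_isomorphic_def
  \<comment> \<open>The unit at \<open>x\<close> is the preimage of \<open>s\<close> at
    \<open>F x\<close>; its naturality is tested after applying the faithful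
    \<open>F\<close>.\<close>
  proof (intro exI[of _ "\<lambda>x. preimage x (g (cfOb F x)) (s (cfOb F x))"] conjI ballI)
    fix x assume x: "x \<in> cOb C"
    then have "cat_iso D (cfOb F x) (cfOb F (g (cfOb F x))) (s (cfOb F x))"
      unfolding cat_iso_def using s t st ts ob_closed by blast
    then show "cat_iso C (cfOb cat_fun_id x) (cfOb (cat_fun_comp G F) x)
        (preimage x (g (cfOb F x)) (s (cfOb F x)))"
      using x g ob_closed by (simp add: cat_fun_comp_def cat_fun_id_def G_ob preimage_iso)
  next
    fix x y f assume xy: "x \<in> cOb C" "y \<in> cOb C" and f: "f \<in> cHom C x y"
    note Fxy = xy[THEN ob_closed]
    note Ff = hom_closed[OF xy f]
    note px = preimage[OF xy(1) g[OF Fxy(1)] s[OF Fxy(1)]]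
    note py = preimage[OF xy(2) g[OF Fxy(2)] s[OF Fxy(2)]]
    have "cComp D (cfOb F x) (cfOb F (g (cfOb F x))) (cfOb F (g (cfOb F y)))
          (conj (cfOb F x) (cfOb F y) (cfHom F x y f)) (s (cfOb F x))
        = cComp D (cfOb F x) (cfOb F y) (cfOb F (g (cfOb F y))) (s (cfOb F y)) (cfHom F x y f)"
      unfolding conj_def using Fxy Ff s t Fg
      by (simp add: D.comp_assoc D.comp_closed ts D.id_right)
    then show "cComp C (cfOb cat_fun_id x) (cfOb cat_fun_id y) (cfOb (cat_fun_comp G F) y)
          (preimage y (g (cfOb F y)) (s (cfOb F y))) (cfHom cat_fun_id x y f) =
        cComp C (cfOb cat_fun_id x) (cfOb (cat_fun_comp G F) x) (cfOb (cat_fun_comp G F) y)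
          (cfHom (cat_fun_comp G F) x y f) (preimage x (g (cfOb F x)) (s (cfOb F x)))"
      unfolding cat_fun_id_def cat_fun_comp_def G_ob
      using xy f Fxy Ff px py g G_hom
      by (intro hom_inj[of x "g (cfOb F y)"]) (auto simp: map_comp intro!: C.comp_closed)
  qed
  ultimately show ?thesis
    unfolding cat_equivalence_def using G cat_functor_axioms by blast
qed

end

section \<open>Homology of complexes of morphisms\<close>

text \<open>Homology is recorded as a quotient of additive groups, so calculations with homology
  classes use linear maps through their additivity.\<close>

lemma linear_maps_hom:
  assumes "module R M" "module R N" "h \<in> linear_maps R M N"
  shows "abelian_group_hom M N h"
  using assms by (intro abelian_group_homI module.axioms(2)[of R])
    (auto simp: linear_maps_def hom_def module_def group_hom_def group_hom_axioms_def
      intro: abelian_group.a_group)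

text \<open>\<open>homology\<close> is a quotient of the record of chains with its carrier cut down
  to the cycles; that record has to be an abelian group again.\<close>

lemma (in abelian_group) subgroup_abelian_group:
  assumes "additive_subgroup H G"
  shows "abelian_group (G\<lparr>carrier := H\<rparr>)"
proof -
  interpret H: additive_subgroup H G by fact
  have "\<exists>y\<in>H. y \<oplus> x = \<zero>" if "x \<in> H" for x
    using that by (intro bexI[of _ "\<ominus> x"] l_neg) auto
  then show ?thesis
    by (intro abelian_groupI) (auto simp: a_ac)
qed

text \<open>Requiring both sides to be cycles gives a partial equivalence relation whose domain is
  the set of cycles, so that membership travels with the relation.\<close>

definition homologous :: "('r, 'o, 'm) dgcat \<Rightarrow> 'o \<Rightarrow> 'o \<Rightarrow> int \<Rightarrow> 'm \<Rightarrow> 'm \<Rightarrow> bool" where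
  "homologous A x y i f g \<longleftrightarrow> f \<in> cycles A x y i \<and> g \<in> cycles A x y i \<and>
    homology_class A x y i f = homology_class A x y i g"

context dg_category
begin

lemma abelian_group_dgHom: "\<lbrakk>x \<in> dgOb A; y \<in> dgOb A\<rbrakk> \<Longrightarrow> abelian_group (dgHom A x y i)"
  using hom_module module.axioms(2) by blast

lemma diff_hom:
  "\<lbrakk>x \<in> dgOb A; y \<in> dgOb A\<rbrakk>
    \<Longrightarrow> abelian_group_hom (dgHom A x y i) (dgHom A x y (i - 1)) (dgDiff A x y i)"
  by (intro linear_maps_hom[of R] hom_module diff_linear)

lemma comp_hom_right:
  "\<lbrakk>x \<in> dgOb A; y \<in> dgOb A; z \<in> dgOb A; g \<in> carrier (dgHom A y z i)\<rbrakk>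
    \<Longrightarrow> abelian_group_hom (dgHom A x y j) (dgHom A x z (i + j)) (dgComp A x y z i j g)"
  using comp_linear_right by (intro linear_maps_hom[of R] hom_module) auto

lemma comp_hom_left:
  "\<lbrakk>x \<in> dgOb A; y \<in> dgOb A; z \<in> dgOb A; f \<in> carrier (dgHom A x y j)\<rbrakk>
    \<Longrightarrow> abelian_group_hom (dgHom A y z i) (dgHom A x z (i + j)) (\<lambda>g. dgComp A x y z i j g f)"
  using comp_linear_left by (intro linear_maps_hom[of R] hom_module) auto

lemma diff_closed:
  "\<lbrakk>x \<in> dgOb A; y \<in> dgOb A; f \<in> carrier (dgHom A x y i)\<rbrakk>
    \<Longrightarrow> dgDiff A x y i f \<in> carrier (dgHom A x y (i - 1))"
  using abelian_group_hom.hom_closed[OF diff_hom] .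

lemma diff_succ_closed:
  "\<lbrakk>x \<in> dgOb A; y \<in> dgOb A; f \<in> carrier (dgHom A x y (i + 1))\<rbrakk>
    \<Longrightarrow> dgDiff A x y (i + 1) f \<in> carrier (dgHom A x y i)"
  using diff_closed[of x y f "i + 1"] by simp

lemma comp_closed:
  "\<lbrakk>x \<in> dgOb A; y \<in> dgOb A; z \<in> dgOb A;
    g \<in> carrier (dgHom A y z i); f \<in> carrier (dgHom A x y j)\<rbrakk>
    \<Longrightarrow> dgComp A x y z i j g f \<in> carrier (dgHom A x z (i + j))"
  using abelian_group_hom.hom_closed[OF comp_hom_right] .

lemma cycles_subgroup:
  assumes "x \<in> dgOb A" "y \<in> dgOb A"
  shows "additive_subgroup (cycles A x y i) (dgHom A x y i)"
proof -
  have "cycles A x y i = a_kernel (dgHom A x y i) (dgHom A x y (i - 1)) (dgDiff A x y i)"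
    by (auto simp: cycles_def a_kernel_def')
  then show ?thesis
    using abelian_group_hom.additive_subgroup_a_kernel[OF diff_hom[OF assms]] by simp
qed

lemma cycles_carrier: "f \<in> cycles A x y i \<Longrightarrow> f \<in> carrier (dgHom A x y i)"
  by (simp add: cycles_def)

lemma boundary_cycle:
  assumes "x \<in> dgOb A" "y \<in> dgOb A" "h \<in> carrier (dgHom A x y (i + 1))"
  shows "dgDiff A x y (i + 1) h \<in> cycles A x y i"
  using diff_succ_closed[OF assms] diff_diff[OF assms] by (simp add: cycles_def)

text \<open>Boundaries are the image of a homomorphism, hence a subgroup of the chains;
  \<open>d d = 0\<close> places them inside the cycles, the group in which \<open>homology\<close>
  takes its quotient.\<close>

lemma boundaries_subgroup:
  assumes "x \<in> dgOb A" "y \<in> dgOb A"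
  shows "abelian_subgroup (boundaries A x y i) (dgHom A x y i\<lparr>carrier := cycles A x y i\<rparr>)"
proof -
  interpret d: abelian_group_hom "dgHom A x y (i + 1)" "dgHom A x y i" "dgDiff A x y (i + 1)"
    using diff_hom[OF assms, of "i + 1"] by simp
  have "subgroup (boundaries A x y i) (add_monoid (dgHom A x y i))"
    using group_hom.subgroup_img_is_subgroup[OF d.a_group_hom d.G.add.subgroup_self]
    by (simp add: boundaries_def)
  moreover have "subgroup (cycles A x y i) (add_monoid (dgHom A x y i))"
    using cycles_subgroup[OF assms] by (simp add: additive_subgroup_def)
  moreover have "boundaries A x y i \<subseteq> cycles A x y i"
    using boundary_cycle[OF assms] by (auto simp: boundaries_def)
  ultimately have "subgroup (boundaries A x y i)
      (add_monoid (dgHom A x y i) \<lparr>carrier := cycles A x y i\<rparr>)"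
    by (rule d.H.add.subgroup_incl)
  then show ?thesis
    using d.H.subgroup_abelian_group[OF cycles_subgroup[OF assms]]
    by (intro abelian_subgroupI3 additive_subgroup.intro) simp_all
qed

text \<open>A coset depends only on the addition, which restricting the carrier leaves alone, so it
  may be formed in all chains or in the cycles.\<close>

lemma homology_class_coset:
  "homology_class A x y i f = boundaries A x y i +>\<^bsub>dgHom A x y i\<lparr>carrier := cycles A x y i\<rparr>\<^esub> f"
  by (simp add: homology_class_def a_r_coset_def r_coset_def)

lemma carrier_homology: "carrier (homology A x y i) = homology_class A x y i ` cycles A x y i"
  by (auto simp: homology_def A_FactGroup_def' A_RCOSETS_def' homology_class_def a_r_coset_def')

lemma homology_mult:
  assumes "x \<in> dgOb A" "y \<in> dgOb A" "f \<in> cycles A x y i" "g \<in> cycles A x y i"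
  shows "homology_class A x y i f \<otimes>\<^bsub>homology A x y i\<^esub> homology_class A x y i g
    = homology_class A x y i (f \<oplus>\<^bsub>dgHom A x y i\<^esub> g)"
  using abelian_subgroup.a_rcos_sum[OF boundaries_subgroup[OF assms(1,2)], of f i g] assms(3,4)
  by (simp add: homology_def homology_class_coset)

lemma homologousI:
  assumes "x \<in> dgOb A" "y \<in> dgOb A" "g \<in> cycles A x y i" "h \<in> carrier (dgHom A x y (i + 1))"
    and "f = dgDiff A x y (i + 1) h \<oplus>\<^bsub>dgHom A x y i\<^esub> g"
  shows "homologous A x y i f g"
proof -
  interpret B: abelian_subgroup "boundaries A x y i" "dgHom A x y i\<lparr>carrier := cycles A x y i\<rparr>"
    using assms(1,2) by (rule boundaries_subgroup)
  interpret Z: additive_subgroup "cycles A x y i" "dgHom A x y i"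
    using assms(1,2) by (rule cycles_subgroup)
  have "f \<in> cycles A x y i"
    using assms boundary_cycle by auto
  moreover have "f \<in> boundaries A x y i +>\<^bsub>dgHom A x y i\<lparr>carrier := cycles A x y i\<rparr>\<^esub> g"
    using assms by (auto simp: a_r_coset_def' boundaries_def)
  ultimately show ?thesis
    unfolding homologous_def homology_class_coset
    using assms B.a_repr_independence'[of f g] by simp
qed

lemma in_homology_class_iff:
  assumes "x \<in> dgOb A" "y \<in> dgOb A" "g \<in> cycles A x y i"
  shows "f \<in> homology_class A x y i g \<longleftrightarrow> homologous A x y i f g"
proof
  assume "f \<in> homology_class A x y i g"
  then show "homologous A x y i f g"
    unfolding homology_class_def a_r_coset_def' boundaries_def
    using homologousI[OF assms] by auto
next
  interpret B: abelian_subgroup "boundaries A x y i" "dgHom A x y i\<lparr>carrier := cycles A x y i\<rparr>"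
    using assms(1,2) by (rule boundaries_subgroup)
  assume "homologous A x y i f g"
  then show "f \<in> homology_class A x y i g"
    using B.a_rcos_self[of f] unfolding homologous_def homology_class_coset by simp
qed

lemma homologousE:
  assumes "x \<in> dgOb A" "y \<in> dgOb A" "homologous A x y i f g"
  obtains h where "h \<in> carrier (dgHom A x y (i + 1))"
    and "f = dgDiff A x y (i + 1) h \<oplus>\<^bsub>dgHom A x y i\<^esub> g"
proof -
  have "f \<in> homology_class A x y i g"
    using assms in_homology_class_iff by (auto simp: homologous_def)
  then show thesis
    using that by (auto simp: homology_class_def a_r_coset_def' boundaries_def)
qed

lemma homologous_zero_iff:
  assumes "x \<in> dgOb A" "y \<in> dgOb A"
  shows "homologous A x y i f \<zero>\<^bsub>dgHom A x y i\<^esub> \<longleftrightarrow>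
    (\<exists>h \<in> carrier (dgHom A x y (i + 1)). f = dgDiff A x y (i + 1) h)"
proof -
  interpret abelian_group "dgHom A x y i"
    using assms by (rule abelian_group_dgHom)
  interpret Z: additive_subgroup "cycles A x y i" "dgHom A x y i"
    using assms by (rule cycles_subgroup)
  show ?thesis
    using homologousI[OF assms Z.zero_closed] homologousE[OF assms] diff_succ_closed[OF assms]
    by (metis r_zero)
qed

text \<open>Turns injectivity on homology into the question whether one cycle is a boundary, the
  form in which bounding chains can be lifted.\<close>

lemma homologous_minus_iff:
  assumes "x \<in> dgOb A" "y \<in> dgOb A" "f \<in> cycles A x y i" "g \<in> cycles A x y i"
  shows "homologous A x y i f g \<longleftrightarrow>
    homologous A x y i (f \<ominus>\<^bsub>dgHom A x y i\<^esub> g) \<zero>\<^bsub>dgHom A x y i\<^esub>"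
proof -
  interpret abelian_group "dgHom A x y i"
    using assms(1,2) by (rule abelian_group_dgHom)
  have fg: "f \<in> carrier (dgHom A x y i)" "g \<in> carrier (dgHom A x y i)"
    using assms by (auto intro: cycles_carrier)
  have *: "f \<ominus>\<^bsub>dgHom A x y i\<^esub> g = dgDiff A x y (i + 1) h \<longleftrightarrow>
      f = dgDiff A x y (i + 1) h \<oplus>\<^bsub>dgHom A x y i\<^esub> g"
    if "h \<in> carrier (dgHom A x y (i + 1))" for h
    using diff_succ_closed[OF assms(1,2) that] fg add.inv_solve_right[of "dgDiff A x y (i + 1) h" f g]
    unfolding a_minus_def by auto
  show ?thesis
    unfolding homologous_zero_iff[OF assms(1,2)]
  proof
    assume "homologous A x y i f g"
    then show "\<exists>h\<in>carrier (dgHom A x y (i + 1)). f \<ominus>\<^bsub>dgHom A x y i\<^esub> g = dgDiff A x y (i + 1) h"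
      by (rule homologousE[OF assms(1,2)]) (use * in blast)
  next
    assume "\<exists>h\<in>carrier (dgHom A x y (i + 1)). f \<ominus>\<^bsub>dgHom A x y i\<^esub> g = dgDiff A x y (i + 1) h"
    then show "homologous A x y i f g"
      using * homologousI[OF assms(1,2,4)] by blast
  qed
qed

lemma homologous_refl: "f \<in> cycles A x y i \<Longrightarrow> homologous A x y i f f"
  by (simp add: homologous_def)

lemma homologous_sym: "homologous A x y i f g \<Longrightarrow> homologous A x y i g f"
  by (simp add: homologous_def)

lemma homologous_trans [trans]:
  "\<lbrakk>homologous A x y i f g; homologous A x y i g h\<rbrakk> \<Longrightarrow> homologous A x y i f h"
  by (simp add: homologous_def)

lemma id_in_cycles: "x \<in> dgOb A \<Longrightarrow> dgId A x \<in> cycles A x x 0"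
  by (simp add: cycles_def id_closed id_cycle)

section \<open>Composition of cycles and boundaries\<close>

lemma koszul_closed:
  "\<lbrakk>x \<in> dgOb A; y \<in> dgOb A; f \<in> carrier (dgHom A x y i)\<rbrakk>
    \<Longrightarrow> koszul (dgHom A x y i) k f \<in> carrier (dgHom A x y i)"
  using abelian_group.a_inv_closed[OF abelian_group_dgHom] by (simp add: koszul_def)

lemma koszul_koszul:
  "\<lbrakk>x \<in> dgOb A; y \<in> dgOb A; f \<in> carrier (dgHom A x y i)\<rbrakk>
    \<Longrightarrow> koszul (dgHom A x y i) k (koszul (dgHom A x y i) k f) = f"
  using abelian_group.minus_minus[OF abelian_group_dgHom] by (simp add: koszul_def)

lemma diff_koszul:
  assumes "x \<in> dgOb A" "y \<in> dgOb A" "f \<in> carrier (dgHom A x y i)"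
  shows "dgDiff A x y i (koszul (dgHom A x y i) k f) = koszul (dgHom A x y (i - 1)) k (dgDiff A x y i f)"
  using abelian_group_hom.hom_a_inv[OF diff_hom[OF assms(1,2)] assms(3)] by (simp add: koszul_def)

lemma comp_cycles:
  assumes ob: "x \<in> dgOb A" "y \<in> dgOb A" "z \<in> dgOb A"
    and g: "g \<in> cycles A y z i" and f: "f \<in> cycles A x y j"
  shows "dgComp A x y z i j g f \<in> cycles A x z (i + j)"
proof -
  note gf = g[THEN cycles_carrier] f[THEN cycles_carrier]
  interpret abelian_group "dgHom A x z (i + j - 1)"
    using ob by (simp add: abelian_group_dgHom)
  have "dgComp A x y z (i - 1) j \<zero>\<^bsub>dgHom A y z (i - 1)\<^esub> f = \<zero>\<^bsub>dgHom A x z (i + j - 1)\<^esub>"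
    using abelian_group_hom.hom_zero[OF comp_hom_left[OF ob gf(2), of "i - 1"]]
    by (simp add: algebra_simps)
  moreover have "dgComp A x y z i (j - 1) g \<zero>\<^bsub>dgHom A x y (j - 1)\<^esub> = \<zero>\<^bsub>dgHom A x z (i + j - 1)\<^esub>"
    using abelian_group_hom.hom_zero[OF comp_hom_right[OF ob gf(1), of "j - 1"]]
    by (simp add: algebra_simps)
  ultimately show ?thesis
    using leibniz[OF ob gf] comp_closed[OF ob gf] f g by (simp add: cycles_def koszul_def)
qed

lemma comp_boundary_left:
  assumes ob: "x \<in> dgOb A" "y \<in> dgOb A" "z \<in> dgOb A"
    and h: "h \<in> carrier (dgHom A y z (i + 1))" and f: "f \<in> cycles A x y j"
  shows "dgComp A x y z i j (dgDiff A y z (i + 1) h) f =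
    dgDiff A x z (i + j + 1) (dgComp A x y z (i + 1) j h f)"
proof -
  note fc = cycles_carrier[OF f]
  have deg: "i + 1 + j = i + j + 1" by simp
  interpret abelian_group "dgHom A x z (i + j)"
    using ob by (simp add: abelian_group_dgHom)
  have "dgComp A x y z (i + 1) (j - 1) h \<zero>\<^bsub>dgHom A x y (j - 1)\<^esub> = \<zero>\<^bsub>dgHom A x z (i + j)\<^esub>"
    using abelian_group_hom.hom_zero[OF comp_hom_right[OF ob h, of "j - 1"]]
    by (simp add: algebra_simps)
  moreover have "dgComp A x y z i j (dgDiff A y z (i + 1) h) f \<in> carrier (dgHom A x z (i + j))"
    using ob h fc by (intro comp_closed diff_succ_closed)
  ultimately show ?thesis
    using leibniz[OF ob h fc] f by (simp add: cycles_def koszul_def deg)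
qed

text \<open>With \<open>g\<close> a cycle, the Leibniz rule leaves the sign \<open>(-1)^i\<close> in
  front of the composite. The sign is its own inverse and commutes with the differential, so it can
  be moved onto the bounding chain.\<close>

lemma comp_boundary_right:
  assumes ob: "x \<in> dgOb A" "y \<in> dgOb A" "z \<in> dgOb A"
    and g: "g \<in> cycles A y z i" and h: "h \<in> carrier (dgHom A x y (j + 1))"
  shows "dgComp A x y z i j g (dgDiff A x y (j + 1) h) =
    dgDiff A x z (i + j + 1) (koszul (dgHom A x z (i + j + 1)) i (dgComp A x y z i (j + 1) g h))"
proof -
  note gc = cycles_carrier[OF g]
  have deg: "i + (j + 1) = i + j + 1" by simp
  interpret abelian_group "dgHom A x z (i + j)"
    using ob by (simp add: abelian_group_dgHom)
  have "dgComp A x y z (i - 1) (j + 1) \<zero>\<^bsub>dgHom A y z (i - 1)\<^esub> h = \<zero>\<^bsub>dgHom A x z (i + j)\<^esub>"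
    using abelian_group_hom.hom_zero[OF comp_hom_left[OF ob h, of "i - 1"]]
    by (simp add: algebra_simps)
  moreover have gdh: "dgComp A x y z i j g (dgDiff A x y (j + 1) h) \<in> carrier (dgHom A x z (i + j))"
    using ob h gc by (intro comp_closed diff_succ_closed)
  ultimately have "dgDiff A x z (i + j + 1) (dgComp A x y z i (j + 1) g h) =
      koszul (dgHom A x z (i + j)) i (dgComp A x y z i j g (dgDiff A x y (j + 1) h))"
    using leibniz[OF ob gc h] g koszul_closed[OF ob(1,3) gdh] by (simp add: cycles_def deg)
  moreover have "dgComp A x y z i (j + 1) g h \<in> carrier (dgHom A x z (i + j + 1))"
    using comp_closed[OF ob gc h] by (simp only: deg)
  ultimately show ?thesis
    using ob gdh by (simp add: diff_koszul koszul_koszul)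
qed

text \<open>One factor changes at a time, through the intermediate composite of \<open>g'\<close>
  and \<open>f\<close>; each difference is a boundary because the other factor is a cycle.\<close>

lemma comp_homologous:
  assumes ob: "x \<in> dgOb A" "y \<in> dgOb A" "z \<in> dgOb A"
    and g: "homologous A y z i g g'" and f: "homologous A x y j f f'"
  shows "homologous A x z (i + j) (dgComp A x y z i j g f) (dgComp A x y z i j g' f')"
proof (rule homologous_trans)
  have cyc: "g \<in> cycles A y z i" "g' \<in> cycles A y z i" "f \<in> cycles A x y j" "f' \<in> cycles A x y j"
    using f g by (auto simp: homologous_def)
  note car = cyc[THEN cycles_carrier]
  obtain h where h: "h \<in> carrier (dgHom A y z (i + 1))"
    "g = dgDiff A y z (i + 1) h \<oplus>\<^bsub>dgHom A y z i\<^esub> g'"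
    using homologousE[OF ob(2,3) g] .
  obtain k where k: "k \<in> carrier (dgHom A x y (j + 1))"
    "f = dgDiff A x y (j + 1) k \<oplus>\<^bsub>dgHom A x y j\<^esub> f'"
    using homologousE[OF ob(1,2) f] .
  show "homologous A x z (i + j) (dgComp A x y z i j g f) (dgComp A x y z i j g' f)"
  proof (rule homologousI)
    show "dgComp A x y z (i + 1) j h f \<in> carrier (dgHom A x z (i + j + 1))"
      using comp_closed[OF ob h(1) car(3)] by (simp add: algebra_simps)
    show "dgComp A x y z i j g f = dgDiff A x z (i + j + 1) (dgComp A x y z (i + 1) j h f)
        \<oplus>\<^bsub>dgHom A x z (i + j)\<^esub> dgComp A x y z i j g' f"
      unfolding comp_boundary_left[OF ob h(1) cyc(3), symmetric] h(2)
      using abelian_group_hom.hom_add[OF comp_hom_left[OF ob car(3)]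
          diff_succ_closed[OF ob(2,3) h(1)] car(2)] .
  qed (use ob cyc in \<open>auto intro: comp_cycles\<close>)
  show "homologous A x z (i + j) (dgComp A x y z i j g' f) (dgComp A x y z i j g' f')"
  proof (rule homologousI)
    show "koszul (dgHom A x z (i + j + 1)) i (dgComp A x y z i (j + 1) g' k)
        \<in> carrier (dgHom A x z (i + j + 1))"
      using comp_closed[OF ob car(2) k(1)] ob by (intro koszul_closed) (simp_all add: algebra_simps)
    show "dgComp A x y z i j g' f = dgDiff A x z (i + j + 1)
          (koszul (dgHom A x z (i + j + 1)) i (dgComp A x y z i (j + 1) g' k))
        \<oplus>\<^bsub>dgHom A x z (i + j)\<^esub> dgComp A x y z i j g' f'"
      unfolding comp_boundary_right[OF ob cyc(2) k(1), symmetric] k(2)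
      using abelian_group_hom.hom_add[OF comp_hom_right[OF ob car(2)]
          diff_succ_closed[OF ob(1,2) k(1)] car(4)] .
  qed (use ob cyc in \<open>auto intro: comp_cycles\<close>)
qed

text \<open>The union in \<open>cComp\<close> runs over all representatives. They all give the same
  class and there is at least one, so the union is that class.\<close>

lemma comp_homology_class:
  assumes ob: "x \<in> dgOb A" "y \<in> dgOb A" "z \<in> dgOb A"
    and g: "g \<in> cycles A y z 0" and f: "f \<in> cycles A x y 0"
  shows "cComp (H0 A) x y z (homology_class A y z 0 g) (homology_class A x y 0 f) =
    homology_class A x z 0 (dgComp A x y z 0 0 g f)"
proof -
  have "homology_class A x z 0 (dgComp A x y z 0 0 g' f') = homology_class A x z 0 (dgComp A x y z 0 0 g f)"
    if "homologous A y z 0 g' g" "homologous A x y 0 f' f" for g' f'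
    using comp_homologous[OF ob that] by (simp add: homologous_def)
  then have *: "homology_class A x z 0 (dgComp A x y z 0 0 g' f') = homology_class A x z 0 (dgComp A x y z 0 0 g f)"
    if "g' \<in> homology_class A y z 0 g" "f' \<in> homology_class A x y 0 f" for g' f'
    using that in_homology_class_iff ob f g by blast
  have "g \<in> homology_class A y z 0 g" "f \<in> homology_class A x y 0 f"
    using in_homology_class_iff ob f g homologous_refl by blast+
  moreover have "(\<Union>g'\<in>X. \<Union>f'\<in>Y. homology_class A x z 0 (dgComp A x y z 0 0 g' f')) =
      (\<Union>g'\<in>X. \<Union>f'\<in>Y. homology_class A x z 0 (dgComp A x y z 0 0 g f))"
    if "X = homology_class A y z 0 g" "Y = homology_class A x y 0 f" for X Y
    using that * by (intro SUP_cong) auto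
  ultimately show ?thesis
    by (auto simp: H0_def)
qed

lemma small_category_H0: "small_category (H0 A)"
proof
  fix x y f assume xy: "x \<in> cOb (H0 A)" "y \<in> cOb (H0 A)" and f: "f \<in> cHom (H0 A) x y"
  then obtain f' where f': "f' \<in> cycles A x y 0" "f = homology_class A x y 0 f'"
    by (auto simp: H0_def carrier_homology)
  show "cComp (H0 A) x y y (cId (H0 A) y) f = f"
    using comp_homology_class[of x y y "dgId A y" f'] xy f' id_in_cycles id_left[of x y f' 0]
      cycles_carrier[OF f'(1)] by (simp add: H0_def)
  show "cComp (H0 A) x x y f (cId (H0 A) x) = f"
    using comp_homology_class[of x x y f' "dgId A x"] xy f' id_in_cycles id_right[of x y f' 0]
      cycles_carrier[OF f'(1)] by (simp add: H0_def)
next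
  fix x y z f g
  assume xyz: "x \<in> cOb (H0 A)" "y \<in> cOb (H0 A)" "z \<in> cOb (H0 A)"
    and f: "f \<in> cHom (H0 A) x y" and g: "g \<in> cHom (H0 A) y z"
  then obtain f' g' where "f' \<in> cycles A x y 0" "f = homology_class A x y 0 f'"
      "g' \<in> cycles A y z 0" "g = homology_class A y z 0 g'"
    by (auto simp: H0_def carrier_homology)
  then show "cComp (H0 A) x y z g f \<in> cHom (H0 A) x z"
    using xyz comp_homology_class[of x y z g' f'] comp_cycles[of x y z g' 0 f' 0]
    by (simp add: H0_def carrier_homology)
next
  fix w x y z f g h
  assume ob: "w \<in> cOb (H0 A)" "x \<in> cOb (H0 A)" "y \<in> cOb (H0 A)" "z \<in> cOb (H0 A)"
    and "f \<in> cHom (H0 A) w x" "g \<in> cHom (H0 A) x y" "h \<in> cHom (H0 A) y z"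
  then obtain f' g' h' where *: "f' \<in> cycles A w x 0" "f = homology_class A w x 0 f'"
      "g' \<in> cycles A x y 0" "g = homology_class A x y 0 g'"
      "h' \<in> cycles A y z 0" "h = homology_class A y z 0 h'"
    by (auto simp: H0_def carrier_homology)
  have ob: "w \<in> dgOb A" "x \<in> dgOb A" "y \<in> dgOb A" "z \<in> dgOb A"
    using ob by (simp_all add: H0_def)
  show "cComp (H0 A) w x z (cComp (H0 A) x y z h g) f = cComp (H0 A) w y z h (cComp (H0 A) w x y g f)"
    using ob * comp_assoc[of w x y z h' 0 g' 0 f' 0] comp_cycles[of x y z h' 0 g' 0]
      comp_cycles[of w x y g' 0 f' 0]
    by (simp add: comp_homology_class cycles_carrier)
qed (auto simp: H0_def carrier_homology id_in_cycles)

text \<open>Representing the inverse class by a cycle \<open>g\<close> turns equations between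
  classes into homologies: \<open>g\<close> is a two-sided inverse of \<open>f\<close> up to
  boundaries.\<close>

lemma H0_invertible_iff:
  assumes "x \<in> dgOb A" "y \<in> dgOb A"
  shows "H0_invertible A x y f \<longleftrightarrow> f \<in> cycles A x y 0 \<and> (\<exists>g \<in> cycles A y x 0.
    homologous A x x 0 (dgComp A x y x 0 0 g f) (dgId A x) \<and>
    homologous A y y 0 (dgComp A y x y 0 0 f g) (dgId A y))"
proof -
  have inverse_iff: "cComp (H0 A) a b a (homology_class A b a 0 v) (homology_class A a b 0 u) = cId (H0 A) a \<longleftrightarrow>
      homologous A a a 0 (dgComp A a b a 0 0 v u) (dgId A a)"
    if "a \<in> dgOb A" "b \<in> dgOb A" "u \<in> cycles A a b 0" "v \<in> cycles A b a 0" for a b u v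
  proof -
    have "cId (H0 A) a = homology_class A a a 0 (dgId A a)"
      by (simp add: H0_def)
    then show ?thesis
      using that comp_cycles[of a b a v 0 u 0] by (simp add: comp_homology_class homologous_def id_in_cycles)
  qed
  have homs: "cHom (H0 A) a b = homology_class A a b 0 ` cycles A a b 0" for a b
    by (simp add: H0_def carrier_homology)
  have "cat_iso (H0 A) x y (homology_class A x y 0 f) \<longleftrightarrow> (\<exists>g \<in> cycles A y x 0.
      homologous A x x 0 (dgComp A x y x 0 0 g f) (dgId A x) \<and>
      homologous A y y 0 (dgComp A y x y 0 0 f g) (dgId A y))" if "f \<in> cycles A x y 0"
    using that assms unfolding cat_iso_def homs bex_simps(7) by (simp add: inverse_iff)
  then show ?thesis
    unfolding H0_invertible_def by blast
qed

end

section \<open>Dg functors on homology\<close>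

text \<open>Injectivity and surjectivity are kept apart, and phrased with cycles, because the
  cancellations behind two out of three use them one at a time.\<close>

definition homology_injective ::
    "('r, 'o, 'm) dgcat \<Rightarrow> ('r, 'p, 'n) dgcat \<Rightarrow> ('o, 'm, 'p, 'n) dgfun \<Rightarrow> 'o \<Rightarrow> 'o \<Rightarrow> int \<Rightarrow> bool" where
  "homology_injective A B F x y i \<longleftrightarrow> (\<forall>f \<in> cycles A x y i. \<forall>g \<in> cycles A x y i.
    homologous B (dgfOb F x) (dgfOb F y) i (dgfHom F x y i f) (dgfHom F x y i g) \<longrightarrow>
    homologous A x y i f g)"

definition homology_surjective ::
    "('r, 'o, 'm) dgcat \<Rightarrow> ('r, 'p, 'n) dgcat \<Rightarrow> ('o, 'm, 'p, 'n) dgfun \<Rightarrow> 'o \<Rightarrow> 'o \<Rightarrow> int \<Rightarrow> bool" where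
  "homology_surjective A B F x y i \<longleftrightarrow> (\<forall>g \<in> cycles B (dgfOb F x) (dgfOb F y) i.
    \<exists>f \<in> cycles A x y i. homologous B (dgfOb F x) (dgfOb F y) i (dgfHom F x y i f) g)"

definition H0_ess_surj ::
    "('r, 'o, 'm) dgcat \<Rightarrow> ('r, 'p, 'n) dgcat \<Rightarrow> ('o, 'm, 'p, 'n) dgfun \<Rightarrow> bool" where
  "H0_ess_surj A B F \<longleftrightarrow> (\<forall>b \<in> dgOb B. \<exists>a \<in> dgOb A. \<exists>v. H0_invertible B (dgfOb F a) b v)"

text \<open>With outer factors of degree 0 that are invertible in \<open>H0\<close>, sending
  \<open>g\<close> to \<open>h g f\<close> identifies the homology of \<open>A(x,y)\<close> with
  that of \<open>A(w,z)\<close>. This is the device for changing objects within an isomorphism class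
  of \<open>H0\<close>.\<close>

definition sandwich ::
    "('r, 'o, 'm) dgcat \<Rightarrow> 'o \<Rightarrow> 'o \<Rightarrow> 'o \<Rightarrow> 'o \<Rightarrow> int \<Rightarrow> 'm \<Rightarrow> 'm \<Rightarrow> 'm \<Rightarrow> 'm" where
  "sandwich A w x y z i h g f = dgComp A w y z 0 i h (dgComp A w x y i 0 g f)"

lemma cOb_H0 [simp]: "cOb (H0 A) = dgOb A"
  by (simp add: H0_def)

lemma H0_fun_simps [simp]:
  "cfOb (H0_fun B F) = dgfOb F" "cfHom (H0_fun B F) x y = homology_map B F x y 0"
  by (simp_all add: H0_fun_def)

context dg_category
begin

section \<open>Conjugation by cycles of degree 0\<close>

lemma sandwich_cycles:
  assumes "w \<in> dgOb A" "x \<in> dgOb A" "y \<in> dgOb A" "z \<in> dgOb A"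
    and "h \<in> cycles A y z 0" "g \<in> cycles A x y i" "f \<in> cycles A w x 0"
  shows "sandwich A w x y z i h g f \<in> cycles A w z i"
  using assms comp_cycles[of w x y g i f 0] comp_cycles[of w y z h 0 _ i] by (simp add: sandwich_def)

lemma sandwich_homologous:
  assumes "w \<in> dgOb A" "x \<in> dgOb A" "y \<in> dgOb A" "z \<in> dgOb A"
    and "h \<in> cycles A y z 0" "homologous A x y i g g'" "f \<in> cycles A w x 0"
  shows "homologous A w z i (sandwich A w x y z i h g f) (sandwich A w x y z i h g' f)"
  using assms comp_homologous[of w x y i g g' 0 f f] comp_homologous[of w y z 0 h h i]
  by (simp add: sandwich_def homologous_refl)

text \<open>By associativity \<open>h' (h g f) f'\<close> equals \<open>(h' h) (g (f f'))\<close>,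
  and the two inner products are homologous to identities. Only these one-sided laws enter.\<close>

lemma sandwich_inverse:
  assumes ob: "w \<in> dgOb A" "x \<in> dgOb A" "y \<in> dgOb A" "z \<in> dgOb A"
    and h: "h \<in> cycles A y z 0" "h' \<in> cycles A z y 0" "homologous A y y 0 (dgComp A y z y 0 0 h' h) (dgId A y)"
    and f: "f \<in> cycles A w x 0" "f' \<in> cycles A x w 0" "homologous A x x 0 (dgComp A x w x 0 0 f f') (dgId A x)"
    and g: "g \<in> cycles A x y i"
  shows "homologous A x y i (sandwich A x w z y i h' (sandwich A w x y z i h g f) f') g"
proof -
  note car = h(1,2)[THEN cycles_carrier] f(1,2)[THEN cycles_carrier] g[THEN cycles_carrier]
  have gff: "dgComp A x x y i 0 g (dgComp A x w x 0 0 f f') \<in> carrier (dgHom A x y i)"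
    and gf: "dgComp A w x y i 0 g f \<in> carrier (dgHom A w y i)"
    and ff: "dgComp A x w x 0 0 f f' \<in> carrier (dgHom A x x 0)"
    using ob car comp_closed[of x w x f 0 f' 0] comp_closed[of x x y g i _ 0] comp_closed[of w x y g i f 0]
    by auto
  have "sandwich A x w z y i h' (sandwich A w x y z i h g f) f' =
      dgComp A x z y 0 i h' (dgComp A x y z 0 i h (dgComp A x x y i 0 g (dgComp A x w x 0 0 f f')))"
    using ob car gf comp_assoc[of x w y z h 0 "dgComp A w x y i 0 g f" i f' 0]
      comp_assoc[of x w x y g i f 0 f' 0]
    by (simp add: sandwich_def)
  also have "\<dots> = dgComp A x y y 0 i (dgComp A y z y 0 0 h' h) (dgComp A x x y i 0 g (dgComp A x w x 0 0 f f'))"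
    using ob car gff comp_assoc[of x y z y h' 0 h 0 _ i] by simp
  finally have eq: "sandwich A x w z y i h' (sandwich A w x y z i h g f) f' = \<dots>" .
  have "homologous A x y i (dgComp A x x y i 0 g (dgComp A x w x 0 0 f f')) (dgComp A x x y i 0 g (dgId A x))"
    using comp_homologous[OF ob(2,2,3) homologous_refl[OF g] f(3)] by simp
  then have "homologous A x y i (dgComp A x x y i 0 g (dgComp A x w x 0 0 f f')) g"
    using ob car id_right by simp
  then have "homologous A x y i (sandwich A x w z y i h' (sandwich A w x y z i h g f) f')
      (dgComp A x y y 0 i (dgId A y) g)"
    unfolding eq using comp_homologous[OF ob(2,3,3) h(3)] by fastforce
  then show ?thesis
    using ob car id_left by simp
qed

lemma H0_invertible_comp:
  assumes ob: "x \<in> dgOb A" "y \<in> dgOb A" "z \<in> dgOb A"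
    and f: "H0_invertible A x y f" and g: "H0_invertible A y z g"
  shows "H0_invertible A x z (dgComp A x y z 0 0 g f)"
  using cat_iso_comp[OF small_category_H0, of x y z "homology_class A x y 0 f" "homology_class A y z 0 g"]
    comp_homology_class[OF ob, of g f]
    comp_cycles[OF ob, of g 0 f 0] assms
  by (auto simp: H0_invertible_def)

end

lemma cat_iso_H0E:
  assumes "dg_category R A" "cat_iso (H0 A) x y t"
  obtains f where "H0_invertible A x y f" "t = homology_class A x y 0 f"
proof -
  have "t \<in> homology_class A x y 0 ` cycles A x y 0"
    using assms dg_category.carrier_homology[OF assms(1)] by (simp add: cat_iso_def H0_def)
  then show thesis
    using that assms(2) by (auto simp: H0_invertible_def)
qed

context dg_functor
begin

lemma map_hom:
  "\<lbrakk>x \<in> dgOb A; y \<in> dgOb A\<rbrakk>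
    \<Longrightarrow> abelian_group_hom (dgHom A x y i) (dgHom B (dgfOb F x) (dgfOb F y) i) (dgfHom F x y i)"
  by (intro linear_maps_hom[of R] A.hom_module B.hom_module ob_closed hom_linear)

lemma map_closed:
  "\<lbrakk>x \<in> dgOb A; y \<in> dgOb A; f \<in> carrier (dgHom A x y i)\<rbrakk>
    \<Longrightarrow> dgfHom F x y i f \<in> carrier (dgHom B (dgfOb F x) (dgfOb F y) i)"
  using abelian_group_hom.hom_closed[OF map_hom] .

lemma map_cycles:
  assumes "x \<in> dgOb A" "y \<in> dgOb A" "f \<in> cycles A x y i"
  shows "dgfHom F x y i f \<in> cycles B (dgfOb F x) (dgfOb F y) i"
  using assms map_closed map_diff[of x y f i] abelian_group_hom.hom_zero[OF map_hom, of x y "i - 1"]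
  by (simp add: cycles_def)

lemma map_homologous:
  assumes "x \<in> dgOb A" "y \<in> dgOb A" "homologous A x y i f g"
  shows "homologous B (dgfOb F x) (dgfOb F y) i (dgfHom F x y i f) (dgfHom F x y i g)"
proof -
  obtain h where h: "h \<in> carrier (dgHom A x y (i + 1))"
    "f = dgDiff A x y (i + 1) h \<oplus>\<^bsub>dgHom A x y i\<^esub> g"
    using A.homologousE[OF assms] .
  have g: "g \<in> cycles A x y i"
    using assms by (simp add: homologous_def)
  have "dgfHom F x y i f = dgDiff B (dgfOb F x) (dgfOb F y) (i + 1) (dgfHom F x y (i + 1) h)
      \<oplus>\<^bsub>dgHom B (dgfOb F x) (dgfOb F y) i\<^esub> dgfHom F x y i g"
    using h g assms(1,2) map_diff[of x y h "i + 1"] A.diff_succ_closed[of x y h i] A.cycles_carrier[OF g]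
    by (simp add: abelian_group_hom.hom_add[OF map_hom])
  then show ?thesis
    using assms h g by (intro B.homologousI) (auto intro: ob_closed map_cycles map_closed)
qed

text \<open>The union in \<open>homology_map\<close> is constant, since homologous cycles have
  homologous images, and its index set is not empty.\<close>

lemma homology_map_class:
  assumes "x \<in> dgOb A" "y \<in> dgOb A" "f \<in> cycles A x y i"
  shows "homology_map B F x y i (homology_class A x y i f) =
    homology_class B (dgfOb F x) (dgfOb F y) i (dgfHom F x y i f)"
proof -
  have eq: "homology_class B (dgfOb F x) (dgfOb F y) i (dgfHom F x y i g) =
      homology_class B (dgfOb F x) (dgfOb F y) i (dgfHom F x y i f)"
    if "g \<in> homology_class A x y i f" for g
  proof -
    have "homologous A x y i g f"
      using that A.in_homology_class_iff[OF assms] by simp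
    then show ?thesis
      using map_homologous[OF assms(1,2)] by (simp add: homologous_def)
  qed
  have "f \<in> homology_class A x y i f"
    using assms by (simp add: A.in_homology_class_iff A.homologous_refl)
  then have "homology_class A x y i f \<noteq> {}"
    by blast
  then show ?thesis
    unfolding homology_map_def using eq by (rule SUP_eq_const)
qed

lemma homology_map_inj_on_iff:
  assumes "x \<in> dgOb A" "y \<in> dgOb A"
  shows "inj_on (homology_map B F x y i) (carrier (homology A x y i)) \<longleftrightarrow> homology_injective A B F x y i"
  using assms
  by (auto simp: A.carrier_homology inj_on_def homology_map_class homology_injective_def
      homologous_def map_cycles)

lemma homology_map_surj_iff:
  assumes "x \<in> dgOb A" "y \<in> dgOb A"
  shows "homology_map B F x y i ` carrier (homology A x y i)
      = carrier (homology B (dgfOb F x) (dgfOb F y) i) \<longleftrightarrow> homology_surjective A B F x y i"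
proof -
  have image: "homology_map B F x y i ` carrier (homology A x y i)
      = (\<lambda>f. homology_class B (dgfOb F x) (dgfOb F y) i (dgfHom F x y i f)) ` cycles A x y i"
    using assms unfolding A.carrier_homology by (auto simp: homology_map_class image_iff)
  have "homology_map B F x y i ` carrier (homology A x y i) \<subseteq> carrier (homology B (dgfOb F x) (dgfOb F y) i)"
    unfolding image B.carrier_homology using map_cycles[OF assms] by auto
  then have "homology_map B F x y i ` carrier (homology A x y i)
      = carrier (homology B (dgfOb F x) (dgfOb F y) i) \<longleftrightarrow>
    carrier (homology B (dgfOb F x) (dgfOb F y) i) \<subseteq> homology_map B F x y i ` carrier (homology A x y i)"
    by (simp add: set_eq_subset)
  also have "\<dots> \<longleftrightarrow> homology_class B (dgfOb F x) (dgfOb F y) i ` cycles B (dgfOb F x) (dgfOb F y) i \<subseteq>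
    (\<lambda>f. homology_class B (dgfOb F x) (dgfOb F y) i (dgfHom F x y i f)) ` cycles A x y i"
    by (simp only: image B.carrier_homology)
  also have "\<dots> \<longleftrightarrow> homology_surjective A B F x y i"
    unfolding homology_surjective_def homologous_def image_subset_iff image_iff
    by (intro ball_cong bex_cong refl) (use map_cycles[OF assms] in \<open>simp add: eq_commute\<close>)
  finally show ?thesis .
qed

text \<open>The induced map respects addition of classes in any case, so being an isomorphism comes
  down to the two conditions on cycles.\<close>

lemma homology_iso_iff:
  assumes "x \<in> dgOb A" "y \<in> dgOb A"
  shows "homology_iso A B F x y i \<longleftrightarrow> homology_injective A B F x y i \<and> homology_surjective A B F x y i"
proof -
  note Fxy = assms[THEN ob_closed]
  have "homology_map B F x y i \<in> hom (homology A x y i) (homology B (dgfOb F x) (dgfOb F y) i)"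
  proof (rule homI)
    fix X assume "X \<in> carrier (homology A x y i)"
    then show "homology_map B F x y i X \<in> carrier (homology B (dgfOb F x) (dgfOb F y) i)"
      using assms map_cycles by (auto simp: A.carrier_homology B.carrier_homology homology_map_class)
  next
    fix X Y assume "X \<in> carrier (homology A x y i)" "Y \<in> carrier (homology A x y i)"
    then obtain f g where fg: "f \<in> cycles A x y i" "g \<in> cycles A x y i"
      and XY: "X = homology_class A x y i f" "Y = homology_class A x y i g"
      by (auto simp: A.carrier_homology)
    have "f \<oplus>\<^bsub>dgHom A x y i\<^esub> g \<in> cycles A x y i"
      using A.cycles_subgroup[OF assms] fg by (simp add: additive_subgroup.a_closed)
    then show "homology_map B F x y i (X \<otimes>\<^bsub>homology A x y i\<^esub> Y) =
        homology_map B F x y i X \<otimes>\<^bsub>homology B (dgfOb F x) (dgfOb F y) i\<^esub> homology_map B F x y i Y"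
      using assms Fxy fg unfolding XY
      by (simp add: A.homology_mult B.homology_mult homology_map_class map_cycles A.cycles_carrier
          abelian_group_hom.hom_add[OF map_hom])
  qed
  then show ?thesis
    using homology_map_inj_on_iff[OF assms] homology_map_surj_iff[OF assms]
    by (auto simp: homology_iso_def iso_def bij_betw_def)
qed

lemma cat_functor_H0: "cat_functor (H0 A) (H0 B) (H0_fun B F)"
proof -
  interpret HA: small_category "H0 A" by (rule A.small_category_H0)
  interpret HB: small_category "H0 B" by (rule B.small_category_H0)
  show ?thesis
  proof
    show "cfOb (H0_fun B F) x \<in> cOb (H0 B)" if "x \<in> cOb (H0 A)" for x
      using that ob_closed by (simp add: H0_fun_def H0_def)
    show "cfHom (H0_fun B F) x y f \<in> cHom (H0 B) (cfOb (H0_fun B F) x) (cfOb (H0_fun B F) y)"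
      if "x \<in> cOb (H0 A)" "y \<in> cOb (H0 A)" "f \<in> cHom (H0 A) x y" for x y f
      using that map_cycles
      by (auto simp: H0_fun_def H0_def A.carrier_homology B.carrier_homology homology_map_class)
    show "cfHom (H0_fun B F) x x (cId (H0 A) x) = cId (H0 B) (cfOb (H0_fun B F) x)"
      if "x \<in> cOb (H0 A)" for x
      using that by (simp add: H0_fun_def H0_def homology_map_class A.id_in_cycles map_id)
    fix x y z f g
    assume ob: "x \<in> cOb (H0 A)" "y \<in> cOb (H0 A)" "z \<in> cOb (H0 A)"
      and "f \<in> cHom (H0 A) x y" "g \<in> cHom (H0 A) y z"
    then obtain f' g' where f': "f' \<in> cycles A x y 0" "f = homology_class A x y 0 f'"
      and g': "g' \<in> cycles A y z 0" "g = homology_class A y z 0 g'"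
      by (auto simp: H0_def A.carrier_homology)
    have ob: "x \<in> dgOb A" "y \<in> dgOb A" "z \<in> dgOb A"
      using ob by (simp_all add: H0_def)
    show "cfHom (H0_fun B F) x z (cComp (H0 A) x y z g f) =
      cComp (H0 B) (cfOb (H0_fun B F) x) (cfOb (H0_fun B F) y) (cfOb (H0_fun B F) z)
        (cfHom (H0_fun B F) y z g) (cfHom (H0_fun B F) x y f)"
      unfolding f'(2) g'(2)
      using ob f'(1) g'(1) A.comp_cycles[of x y z g' 0 f' 0] map_comp[of x y z g' 0 f' 0]
      by (simp add: H0_fun_def A.comp_homology_class B.comp_homology_class homology_map_class
          map_cycles ob_closed A.cycles_carrier)
  qed
qed

lemma H0_invertible_map:
  assumes "x \<in> dgOb A" "y \<in> dgOb A" "H0_invertible A x y f"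
  shows "H0_invertible B (dgfOb F x) (dgfOb F y) (dgfHom F x y 0 f)"
  using assms cat_functor.cat_iso_map[OF cat_functor_H0, of x y "homology_class A x y 0 f"]
  by (auto simp: H0_invertible_def map_cycles homology_map_class)

lemma fully_faithful_H0:
  assumes "\<And>x y. \<lbrakk>x \<in> dgOb A; y \<in> dgOb A\<rbrakk> \<Longrightarrow> homology_iso A B F x y 0"
  shows "fully_faithful_functor (H0 A) (H0 B) (H0_fun B F)"
  using cat_functor_H0 assms
  by (intro fully_faithful_functor.intro fully_faithful_functor_axioms.intro)
    (auto simp: H0_def H0_fun_def homology_iso_def iso_def)

text \<open>Degree 0 of the homology condition makes the functor fully faithful on
  \<open>H0\<close>; essential surjectivity then completes it to an equivalence.\<close>

lemma quasi_equivalenceI: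
  assumes iso: "\<And>x y i. \<lbrakk>x \<in> dgOb A; y \<in> dgOb A\<rbrakk> \<Longrightarrow> homology_iso A B F x y i"
    and ess: "H0_ess_surj A B F"
  shows "quasi_equivalence R A B F"
proof -
  interpret H0: fully_faithful_functor "H0 A" "H0 B" "H0_fun B F"
    using iso by (rule fully_faithful_H0)
  have "cat_equivalence (H0 A) (H0 B) (H0_fun B F)"
    using ess unfolding H0_ess_surj_def H0_invertible_def by (intro H0.equivalence) (simp, blast)
  then show ?thesis
    using iso dg_functor_axioms by (simp add: quasi_equivalence_def)
qed

text \<open>The quasi-inverse supplies the object \<open>a\<close>, and the component of the counit
  at \<open>b\<close> supplies the isomorphism.\<close>

lemma H0_ess_surj_if_equivalence:
  assumes "cat_equivalence (H0 A) (H0 B) (H0_fun B F)"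
  shows "H0_ess_surj A B F"
  unfolding H0_ess_surj_def
proof
  fix b assume b: "b \<in> dgOb B"
  obtain G where G: "cat_functor (H0 B) (H0 A) G"
    and FG: "naturally_isomorphic (H0 B) (H0 B) (cat_fun_comp (H0_fun B F) G) cat_fun_id"
    using assms unfolding cat_equivalence_def by blast
  have "cfOb G b \<in> dgOb A"
    using cat_functor.ob_closed[OF G, of b] b by simp
  moreover obtain t where "cat_iso (H0 B) (dgfOb F (cfOb G b)) b t"
    using FG b by (auto simp: naturally_isomorphic_def cat_fun_comp_def cat_fun_id_def)
  ultimately show "\<exists>a\<in>dgOb A. \<exists>v. H0_invertible B (dgfOb F a) b v"
    using cat_iso_H0E[OF B.dg_category_axioms] by metis
qed

section \<open>Invariance of homology conditions under isomorphisms in \<open>H0\<close>\<close>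

lemma map_sandwich:
  assumes "w \<in> dgOb A" "x \<in> dgOb A" "y \<in> dgOb A" "z \<in> dgOb A"
    and "h \<in> cycles A y z 0" "g \<in> cycles A x y i" "f \<in> cycles A w x 0"
  shows "dgfHom F w z i (sandwich A w x y z i h g f) =
    sandwich B (dgfOb F w) (dgfOb F x) (dgfOb F y) (dgfOb F z) i
      (dgfHom F y z 0 h) (dgfHom F x y i g) (dgfHom F w x 0 f)"
  using assms map_comp[of w x y g i f 0] map_comp[of w y z h 0 _ i] A.comp_closed[of w x y g i f 0]
  by (simp add: sandwich_def A.cycles_carrier)

text \<open>Conjugation takes cycles from \<open>x\<close> to \<open>y\<close> to cycles from
  \<open>a\<close> to \<open>b\<close> and is compatible with \<open>F\<close>. Injectivity at
  \<open>a\<close>, \<open>b\<close> applies to the conjugates, and conjugating back recovers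
  \<open>f\<close> and \<open>g\<close> up to boundaries.\<close>

lemma homology_injective_transport:
  assumes ob: "a \<in> dgOb A" "b \<in> dgOb A" "x \<in> dgOb A" "y \<in> dgOb A"
    and u: "H0_invertible A a x u" and v: "H0_invertible A b y v"
    and inj: "homology_injective A B F a b i"
  shows "homology_injective A B F x y i"
  unfolding homology_injective_def
proof (intro ballI impI)
  fix f g assume f: "f \<in> cycles A x y i" and g: "g \<in> cycles A x y i"
    and hom: "homologous B (dgfOb F x) (dgfOb F y) i (dgfHom F x y i f) (dgfHom F x y i g)"
  obtain u' where u: "u \<in> cycles A a x 0" "u' \<in> cycles A x a 0"
      "homologous A x x 0 (dgComp A x a x 0 0 u u') (dgId A x)"
    using u ob A.H0_invertible_iff by blast
  obtain v' where v: "v \<in> cycles A b y 0" "v' \<in> cycles A y b 0"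
      "homologous A y y 0 (dgComp A y b y 0 0 v v') (dgId A y)"
    using v ob A.H0_invertible_iff by blast
  note from_ab = A.sandwich_inverse[OF ob(1,3,4,2) v(2,1,3) u]
  note to_ab = A.sandwich_cycles[OF ob(1,3,4,2) v(2) _ u(1)]
  have "homologous B (dgfOb F a) (dgfOb F b) i
      (dgfHom F a b i (sandwich A a x y b i v' f u)) (dgfHom F a b i (sandwich A a x y b i v' g u))"
    using ob u v f g hom by (simp add: map_sandwich B.sandwich_homologous ob_closed map_cycles)
  then have "homologous A a b i (sandwich A a x y b i v' f u) (sandwich A a x y b i v' g u)"
    using inj to_ab[OF f] to_ab[OF g] by (simp add: homology_injective_def)
  then have "homologous A x y i (sandwich A x a b y i v (sandwich A a x y b i v' f u) u')
      (sandwich A x a b y i v (sandwich A a x y b i v' g u) u')"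
    by (rule A.sandwich_homologous[OF ob(3,1,2,4) v(1) _ u(2)])
  then show "homologous A x y i f g"
    using from_ab[OF f] from_ab[OF g] by (simp add: homologous_def)
qed

text \<open>A cycle \<open>g\<close> of \<open>B\<close> is conjugated to one between the images of
  \<open>a\<close> and \<open>b\<close>, matched up to a boundary by the image of a cycle
  \<open>k\<close> of \<open>A\<close>, and \<open>k\<close> is conjugated back in
  \<open>A\<close>.\<close>

lemma homology_surjective_transport:
  assumes ob: "a \<in> dgOb A" "b \<in> dgOb A" "x \<in> dgOb A" "y \<in> dgOb A"
    and u: "H0_invertible A a x u" and v: "H0_invertible A b y v"
    and surj: "homology_surjective A B F a b i"
  shows "homology_surjective A B F x y i"
  unfolding homology_surjective_def
proof
  fix g assume g: "g \<in> cycles B (dgfOb F x) (dgfOb F y) i"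
  obtain u' where u: "u \<in> cycles A a x 0" "u' \<in> cycles A x a 0"
      "homologous A x x 0 (dgComp A x a x 0 0 u u') (dgId A x)"
    using u ob A.H0_invertible_iff by blast
  obtain v' where v: "v \<in> cycles A b y 0" "v' \<in> cycles A y b 0"
      "homologous A y y 0 (dgComp A y b y 0 0 v v') (dgId A y)"
    using v ob A.H0_invertible_iff by blast
  note Fob = ob[THEN ob_closed]
  note Fu = map_cycles[OF ob(1,3) u(1)] map_cycles[OF ob(3,1) u(2)]
  note Fv = map_cycles[OF ob(2,4) v(1)] map_cycles[OF ob(4,2) v(2)]
  \<comment> \<open>\<open>F\<close> keeps \<open>u u'\<close> and \<open>v v'\<close> homologous to
    identities, so conjugation by the images can be undone in \<open>B\<close>.\<close>
  have Fuu: "homologous B (dgfOb F x) (dgfOb F x) 0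
      (dgComp B (dgfOb F x) (dgfOb F a) (dgfOb F x) 0 0 (dgfHom F a x 0 u) (dgfHom F x a 0 u')) (dgId B (dgfOb F x))"
    using map_homologous[OF ob(3,3) u(3)] map_comp[of x a x u 0 u' 0] ob u
    by (simp add: A.cycles_carrier map_id)
  have Fvv: "homologous B (dgfOb F y) (dgfOb F y) 0
      (dgComp B (dgfOb F y) (dgfOb F b) (dgfOb F y) 0 0 (dgfHom F b y 0 v) (dgfHom F y b 0 v')) (dgId B (dgfOb F y))"
    using map_homologous[OF ob(4,4) v(3)] map_comp[of y b y v 0 v' 0] ob v
    by (simp add: A.cycles_carrier map_id)
  obtain k where k: "k \<in> cycles A a b i"
    and k_hom: "homologous B (dgfOb F a) (dgfOb F b) i (dgfHom F a b i k)
      (sandwich B (dgfOb F a) (dgfOb F x) (dgfOb F y) (dgfOb F b) i (dgfHom F y b 0 v') g (dgfHom F a x 0 u))"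
    using surj B.sandwich_cycles[OF Fob(1,3,4,2) Fv(2) g Fu(1)] unfolding homology_surjective_def by blast
  show "\<exists>f\<in>cycles A x y i. homologous B (dgfOb F x) (dgfOb F y) i (dgfHom F x y i f) g"
  proof (intro bexI)
    show "sandwich A x a b y i v k u' \<in> cycles A x y i"
      using ob u v k by (intro A.sandwich_cycles)
    show "homologous B (dgfOb F x) (dgfOb F y) i (dgfHom F x y i (sandwich A x a b y i v k u')) g"
      unfolding map_sandwich[OF ob(3,1,2,4) v(1) k u(2)]
      using B.homologous_trans[OF B.sandwich_homologous[OF Fob(3,1,2,4) Fv(1) k_hom Fu(2)]
        B.sandwich_inverse[OF Fob(1,3,4,2) Fv(2,1) Fvv Fu Fuu g]] .
  qed
qed

end

section \<open>Composition and cancellation of dg functors on homology\<close>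

lemma dg_functor_comp:
  assumes "dg_functor R A B F" "dg_functor R B C G"
  shows "dg_functor R A C (dgfun_comp G F)"
proof -
  interpret F: dg_functor R A B F by fact
  interpret G: dg_functor R B C G by fact
  show ?thesis
  proof
    fix x y i assume "x \<in> dgOb A" "y \<in> dgOb A"
    then show "dgfHom (dgfun_comp G F) x y i \<in> linear_maps R (dgHom A x y i)
        (dgHom C (dgfOb (dgfun_comp G F) x) (dgfOb (dgfun_comp G F) y) i)"
      using F.hom_linear[of x y i] G.hom_linear[of "dgfOb F x" "dgfOb F y" i] F.ob_closed
      by (auto simp: dgfun_comp_def linear_maps_def Pi_iff)
  qed (simp_all add: dgfun_comp_def F.ob_closed G.ob_closed F.map_diff G.map_diff F.map_closed
      F.map_id G.map_id F.map_comp G.map_comp)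
qed

lemma homology_injective_comp:
  assumes "dg_functor R A B F" "x \<in> dgOb A" "y \<in> dgOb A"
    and "homology_injective A B F x y i" "homology_injective B C G (dgfOb F x) (dgfOb F y) i"
  shows "homology_injective A C (dgfun_comp G F) x y i"
  using assms dg_functor.map_cycles[OF assms(1-3)] by (auto simp: homology_injective_def dgfun_comp_def)

lemma homology_surjective_comp:
  assumes F: "dg_functor R A B F" and G: "dg_functor R B C G" and ob: "x \<in> dgOb A" "y \<in> dgOb A"
    and "homology_surjective A B F x y i" "homology_surjective B C G (dgfOb F x) (dgfOb F y) i"
  shows "homology_surjective A C (dgfun_comp G F) x y i"
  unfolding homology_surjective_def
proof
  fix g assume "g \<in> cycles C (dgfOb (dgfun_comp G F) x) (dgfOb (dgfun_comp G F) y) i"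
  then obtain h where h: "h \<in> cycles B (dgfOb F x) (dgfOb F y) i"
    "homologous C (dgfOb G (dgfOb F x)) (dgfOb G (dgfOb F y)) i (dgfHom G (dgfOb F x) (dgfOb F y) i h) g"
    using assms(6) by (auto simp: homology_surjective_def dgfun_comp_def)
  then obtain f where f: "f \<in> cycles A x y i" "homologous B (dgfOb F x) (dgfOb F y) i (dgfHom F x y i f) h"
    using assms(5) by (auto simp: homology_surjective_def)
  have "homologous C (dgfOb G (dgfOb F x)) (dgfOb G (dgfOb F y)) i
      (dgfHom G (dgfOb F x) (dgfOb F y) i (dgfHom F x y i f)) (dgfHom G (dgfOb F x) (dgfOb F y) i h)"
    using dg_functor.map_homologous[OF G] dg_functor.ob_closed[OF F] ob f by blast
  then show "\<exists>f\<in>cycles A x y i. homologous C (dgfOb (dgfun_comp G F) x) (dgfOb (dgfun_comp G F) y) i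
      (dgfHom (dgfun_comp G F) x y i f) g"
    using h f by (intro bexI[of _ f]) (auto simp: dgfun_comp_def homologous_def)
qed

lemma homology_injective_compD:
  assumes "dg_functor R A B F" "dg_functor R B C G" "x \<in> dgOb A" "y \<in> dgOb A"
    and "homology_injective A C (dgfun_comp G F) x y i"
  shows "homology_injective A B F x y i"
  using assms dg_functor.map_homologous[OF assms(2)] dg_functor.ob_closed[OF assms(1)]
  by (auto simp: homology_injective_def dgfun_comp_def)

lemma homology_surjective_compD:
  assumes "dg_functor R A B F" "x \<in> dgOb A" "y \<in> dgOb A"
    and "homology_surjective A C (dgfun_comp G F) x y i"
  shows "homology_surjective B C G (dgfOb F x) (dgfOb F y) i"
  using assms(4) dg_functor.map_cycles[OF assms(1-3)]
  by (fastforce simp: homology_surjective_def dgfun_comp_def)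

text \<open>A cycle of \<open>A\<close> whose image under \<open>G F\<close> is homologous to
  \<open>G g\<close> already has image homologous to \<open>g\<close> under \<open>F\<close>,
  because \<open>G\<close> is injective on classes.\<close>

lemma homology_surjective_cancel_left:
  assumes F: "dg_functor R A B F" and "x \<in> dgOb A" "y \<in> dgOb A"
    and G: "dg_functor R B C G"
    and GF: "homology_surjective A C (dgfun_comp G F) x y i"
    and inj: "homology_injective B C G (dgfOb F x) (dgfOb F y) i"
  shows "homology_surjective A B F x y i"
  unfolding homology_surjective_def
proof
  fix g assume g: "g \<in> cycles B (dgfOb F x) (dgfOb F y) i"
  then have "dgfHom G (dgfOb F x) (dgfOb F y) i g \<in> cycles C (dgfOb G (dgfOb F x)) (dgfOb G (dgfOb F y)) i"
    using dg_functor.map_cycles[OF G] dg_functor.ob_closed[OF F] assms(2,3) by blast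
  then obtain f where "f \<in> cycles A x y i" "homologous C (dgfOb G (dgfOb F x)) (dgfOb G (dgfOb F y)) i
      (dgfHom G (dgfOb F x) (dgfOb F y) i (dgfHom F x y i f)) (dgfHom G (dgfOb F x) (dgfOb F y) i g)"
    using GF by (auto simp: homology_surjective_def dgfun_comp_def)
  then show "\<exists>f\<in>cycles A x y i. homologous B (dgfOb F x) (dgfOb F y) i (dgfHom F x y i f) g"
    using inj g dg_functor.map_cycles[OF assms(1-3)] by (auto simp: homology_injective_def)
qed

text \<open>Up to boundaries both cycles are images of cycles of \<open>A\<close>, where injectivity
  of \<open>G F\<close> applies.\<close>

lemma homology_injective_cancel_right:
  assumes F: "dg_functor R A B F" and G: "dg_functor R B C G" and ob: "x \<in> dgOb A" "y \<in> dgOb A"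
    and GF: "homology_injective A C (dgfun_comp G F) x y i"
    and surj: "homology_surjective A B F x y i"
  shows "homology_injective B C G (dgfOb F x) (dgfOb F y) i"
  unfolding homology_injective_def
proof (intro ballI impI)
  interpret F: dg_functor R A B F by fact
  interpret G: dg_functor R B C G by fact
  fix f g assume fg: "f \<in> cycles B (dgfOb F x) (dgfOb F y) i" "g \<in> cycles B (dgfOb F x) (dgfOb F y) i"
    and hom: "homologous C (dgfOb G (dgfOb F x)) (dgfOb G (dgfOb F y)) i
      (dgfHom G (dgfOb F x) (dgfOb F y) i f) (dgfHom G (dgfOb F x) (dgfOb F y) i g)"
  obtain f' where f': "f' \<in> cycles A x y i" "homologous B (dgfOb F x) (dgfOb F y) i (dgfHom F x y i f') f"
    using surj fg(1) unfolding homology_surjective_def by blast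
  obtain g' where g': "g' \<in> cycles A x y i" "homologous B (dgfOb F x) (dgfOb F y) i (dgfHom F x y i g') g"
    using surj fg(2) unfolding homology_surjective_def by blast
  note Fob = ob[THEN F.ob_closed]
  have "homologous C (dgfOb G (dgfOb F x)) (dgfOb G (dgfOb F y)) i
      (dgfHom G (dgfOb F x) (dgfOb F y) i (dgfHom F x y i f')) (dgfHom G (dgfOb F x) (dgfOb F y) i (dgfHom F x y i g'))"
    using G.map_homologous[OF Fob f'(2)] G.map_homologous[OF Fob g'(2)] hom by (simp add: homologous_def)
  then have "homologous A x y i f' g'"
    using GF f' g' by (simp add: homology_injective_def dgfun_comp_def)
  then show "homologous B (dgfOb F x) (dgfOb F y) i f g"
    using F.map_homologous[OF ob, of i f' g'] f' g' by (simp add: homologous_def)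
qed

lemma H0_ess_surj_comp:
  assumes F: "dg_functor R A B F" and G: "dg_functor R B C G"
    and "H0_ess_surj A B F" "H0_ess_surj B C G"
  shows "H0_ess_surj A C (dgfun_comp G F)"
  unfolding H0_ess_surj_def
proof
  interpret F: dg_functor R A B F by fact
  interpret G: dg_functor R B C G by fact
  fix c assume c: "c \<in> dgOb C"
  then obtain b w where b: "b \<in> dgOb B" "H0_invertible C (dgfOb G b) c w"
    using assms(4) unfolding H0_ess_surj_def by blast
  then obtain a v where a: "a \<in> dgOb A" "H0_invertible B (dgfOb F a) b v"
    using assms(3) unfolding H0_ess_surj_def by blast
  have "H0_invertible C (dgfOb G (dgfOb F a)) (dgfOb G b) (dgfHom G (dgfOb F a) b 0 v)"
    using a b F.ob_closed G.H0_invertible_map by blast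
  then have "\<exists>w. H0_invertible C (dgfOb G (dgfOb F a)) c w"
    using a b c F.ob_closed G.ob_closed G.B.H0_invertible_comp by blast
  then show "\<exists>a\<in>dgOb A. \<exists>w. H0_invertible C (dgfOb (dgfun_comp G F) a) c w"
    using a by (auto simp: dgfun_comp_def)
qed

text \<open>\<open>G\<close> is fully faithful on \<open>H0\<close>, so an isomorphism from
  \<open>G (F a)\<close> to \<open>G b\<close> is the image of one from \<open>F a\<close> to
  \<open>b\<close>. With \<open>G\<close> a projection, this reaches the objects of the
  limit.\<close>

lemma H0_ess_surj_cancel_left:
  assumes F: "dg_functor R A B F" and G: "dg_functor R B C G"
    and iso: "\<And>x y. \<lbrakk>x \<in> dgOb B; y \<in> dgOb B\<rbrakk> \<Longrightarrow> homology_iso B C G x y 0"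
    and ess: "H0_ess_surj A C (dgfun_comp G F)"
  shows "H0_ess_surj A B F"
  unfolding H0_ess_surj_def
proof
  interpret F: dg_functor R A B F by fact
  interpret G: dg_functor R B C G by fact
  interpret H0: fully_faithful_functor "H0 B" "H0 C" "H0_fun C G"
    using iso by (rule G.fully_faithful_H0)
  fix b assume b: "b \<in> dgOb B"
  then have "dgfOb G b \<in> dgOb C"
    by (rule G.ob_closed)
  then obtain a v where a: "a \<in> dgOb A" "H0_invertible C (dgfOb G (dgfOb F a)) (dgfOb G b) v"
    using ess unfolding H0_ess_surj_def dgfun_comp_def dgfun.simps by blast
  then have "\<exists>t. cat_iso (H0 B) (dgfOb F a) b t"
    using b H0.preimage_iso[of "dgfOb F a" b] F.ob_closed
    by (auto simp: H0_invertible_def)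
  then show "\<exists>a\<in>dgOb A. \<exists>v. H0_invertible B (dgfOb F a) b v"
    using a cat_iso_H0E[OF F.B.dg_category_axioms] by metis
qed

section \<open>Towers of fibrations\<close>

context dg_functor
begin

text \<open>Surjectivity on homology gives a cycle \<open>c\<close> with
  \<open>g = d e + F c\<close>. Lifting \<open>e\<close> to a chain \<open>e'\<close> and adding
  \<open>d e'\<close> to \<open>c\<close> hits \<open>g\<close> itself and not only its
  class.\<close>

lemma lift_cycle:
  assumes ob: "x \<in> dgOb A" "y \<in> dgOb A"
    and surj: "\<And>k. dgfHom F x y k ` carrier (dgHom A x y k) = carrier (dgHom B (dgfOb F x) (dgfOb F y) k)"
    and "homology_surjective A B F x y i" "g \<in> cycles B (dgfOb F x) (dgfOb F y) i"
  obtains f where "f \<in> cycles A x y i" "dgfHom F x y i f = g"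
proof -
  note Fob = ob[THEN ob_closed]
  interpret BH: abelian_group "dgHom B (dgfOb F x) (dgfOb F y) i"
    using Fob by (rule B.abelian_group_dgHom)
  interpret Z: additive_subgroup "cycles A x y i" "dgHom A x y i"
    using ob by (rule A.cycles_subgroup)
  obtain c where c: "c \<in> cycles A x y i"
      "homologous B (dgfOb F x) (dgfOb F y) i g (dgfHom F x y i c)"
    using assms(4,5) B.homologous_sym unfolding homology_surjective_def by blast
  obtain e where e: "e \<in> carrier (dgHom B (dgfOb F x) (dgfOb F y) (i + 1))"
      "g = dgDiff B (dgfOb F x) (dgfOb F y) (i + 1) e
        \<oplus>\<^bsub>dgHom B (dgfOb F x) (dgfOb F y) i\<^esub> dgfHom F x y i c"
    using B.homologousE[OF Fob c(2)] .
  have "e \<in> dgfHom F x y (i + 1) ` carrier (dgHom A x y (i + 1))"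
    unfolding surj by (rule e(1))
  then obtain e' where e': "e' \<in> carrier (dgHom A x y (i + 1))" "dgfHom F x y (i + 1) e' = e"
    by auto
  show thesis
  proof
    show "dgDiff A x y (i + 1) e' \<oplus>\<^bsub>dgHom A x y i\<^esub> c \<in> cycles A x y i"
      using A.boundary_cycle[OF ob e'(1)] c(1) by simp
    show "dgfHom F x y i (dgDiff A x y (i + 1) e' \<oplus>\<^bsub>dgHom A x y i\<^esub> c) = g"
      using map_diff[OF ob e'(1)] A.diff_succ_closed[OF ob e'(1)] A.cycles_carrier[OF c(1)] e(2) e'(2)
      by (simp add: abelian_group_hom.hom_add[OF map_hom[OF ob]])
  qed
qed

text \<open>The kernel of \<open>F\<close> on complexes of morphisms has no homology in degree \<open>i\<close>, so bounding
  chains can be lifted along \<open>F\<close>.\<close>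

lemma lift_boundary:
  assumes ob: "x \<in> dgOb A" "y \<in> dgOb A"
    and surj: "\<And>k. dgfHom F x y k ` carrier (dgHom A x y k) = carrier (dgHom B (dgfOb F x) (dgfOb F y) k)"
    and hinj: "homology_injective A B F x y i" and hsurj: "homology_surjective A B F x y (i + 1)"
    and g: "g \<in> cycles A x y i"
    and h: "h \<in> carrier (dgHom B (dgfOb F x) (dgfOb F y) (i + 1))"
    and dh: "dgDiff B (dgfOb F x) (dgfOb F y) (i + 1) h = dgfHom F x y i g"
  obtains h' where "h' \<in> carrier (dgHom A x y (i + 1))" "dgfHom F x y (i + 1) h' = h"
    "dgDiff A x y (i + 1) h' = g"
proof -
  note Fob = ob[THEN ob_closed]
  interpret AH: abelian_group "dgHom A x y (i + 1)"
    using ob by (rule A.abelian_group_dgHom)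
  interpret AH': abelian_group "dgHom A x y i"
    using ob by (rule A.abelian_group_dgHom)
  interpret BH: abelian_group "dgHom B (dgfOb F x) (dgfOb F y) (i + 1)"
    using Fob by (rule B.abelian_group_dgHom)
  interpret dA: abelian_group_hom "dgHom A x y (i + 1)" "dgHom A x y i" "dgDiff A x y (i + 1)"
    using A.diff_hom[OF ob, of "i + 1"] by simp
  interpret dB: abelian_group_hom "dgHom B (dgfOb F x) (dgfOb F y) (i + 1)"
    "dgHom B (dgfOb F x) (dgfOb F y) i" "dgDiff B (dgfOb F x) (dgfOb F y) (i + 1)"
    using B.diff_hom[OF Fob, of "i + 1"] by simp
  interpret F: abelian_group_hom "dgHom A x y (i + 1)" "dgHom B (dgfOb F x) (dgfOb F y) (i + 1)"
    "dgfHom F x y (i + 1)"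
    using ob by (rule map_hom)
  have zero: "\<zero>\<^bsub>dgHom A x y i\<^esub> \<in> cycles A x y i"
    using additive_subgroup.zero_closed[OF A.cycles_subgroup[OF ob]] .
  \<comment> \<open>The chain \<open>h\<close> bounds \<open>F g\<close>, so injectivity makes
    \<open>g\<close> the boundary of some \<open>k\<close>, whose image need not be \<open>h\<close>
    yet.\<close>
  have "homologous B (dgfOb F x) (dgfOb F y) i (dgfHom F x y i g) (dgfHom F x y i \<zero>\<^bsub>dgHom A x y i\<^esub>)"
    unfolding abelian_group_hom.hom_zero[OF map_hom[OF ob]] B.homologous_zero_iff[OF Fob]
    using h dh[symmetric] by (rule bexI[rotated])
  then have "homologous A x y i g \<zero>\<^bsub>dgHom A x y i\<^esub>"
    using hinj g zero by (simp add: homology_injective_def)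
  then obtain k where k: "k \<in> carrier (dgHom A x y (i + 1))" "dgDiff A x y (i + 1) k = g"
    by (auto simp: A.homologous_zero_iff[OF ob])
  \<comment> \<open>\<open>F k\<close> and \<open>h\<close> have the same boundary
    \<open>F g\<close>, so their difference is a cycle of degree \<open>i + 1\<close>. Surjectivity
    in that degree lifts it to a cycle \<open>c'\<close>, and \<open>k - c'\<close> has the right
    image without a change of boundary.\<close>
  define c where "c = dgfHom F x y (i + 1) k \<ominus>\<^bsub>dgHom B (dgfOb F x) (dgfOb F y) (i + 1)\<^esub> h"
  have c: "c \<in> cycles B (dgfOb F x) (dgfOb F y) (i + 1)"
    using h k dh map_diff[OF ob k(1)] map_closed[OF ob A.cycles_carrier[OF g]]
    by (simp add: c_def cycles_def a_minus_def dB.H.r_neg)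
  obtain c' where c': "c' \<in> cycles A x y (i + 1)" "dgfHom F x y (i + 1) c' = c"
    using lift_cycle[OF ob surj hsurj c] .
  have c'_car: "c' \<in> carrier (dgHom A x y (i + 1))" "dgDiff A x y (i + 1) c' = \<zero>\<^bsub>dgHom A x y i\<^esub>"
    using c'(1) by (simp_all add: cycles_def)
  show thesis
  proof
    show "k \<ominus>\<^bsub>dgHom A x y (i + 1)\<^esub> c' \<in> carrier (dgHom A x y (i + 1))"
      using k c'_car by simp
    show "dgfHom F x y (i + 1) (k \<ominus>\<^bsub>dgHom A x y (i + 1)\<^esub> c') = h"
      using k c'_car c'(2) h by (simp add: a_minus_def c_def BH.minus_add BH.r_neg2)
    show "dgDiff A x y (i + 1) (k \<ominus>\<^bsub>dgHom A x y (i + 1)\<^esub> c') = g"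
      using k c'_car A.cycles_carrier[OF g] by (simp add: a_minus_def)
  qed
qed

end

section \<open>The strict limit of a tower as a dg category\<close>

lemma tower_lim_simps:
  "dgOb (tower_lim T p) = {x. \<forall>n. x n \<in> dgOb (T n) \<and> dgfOb (p n) (x (Suc n)) = x n}"
  "carrier (dgHom (tower_lim T p) x y i) = {f. \<forall>n. f n \<in> carrier (dgHom (T n) (x n) (y n) i) \<and>
        dgfHom (p n) (x (Suc n)) (y (Suc n)) i (f (Suc n)) = f n}"
  "\<zero>\<^bsub>dgHom (tower_lim T p) x y i\<^esub> = (\<lambda>n. \<zero>\<^bsub>dgHom (T n) (x n) (y n) i\<^esub>)"
  "f \<oplus>\<^bsub>dgHom (tower_lim T p) x y i\<^esub> g = (\<lambda>n. f n \<oplus>\<^bsub>dgHom (T n) (x n) (y n) i\<^esub> g n)"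
  "a \<odot>\<^bsub>dgHom (tower_lim T p) x y i\<^esub> f = (\<lambda>n. a \<odot>\<^bsub>dgHom (T n) (x n) (y n) i\<^esub> f n)"
  "dgDiff (tower_lim T p) x y i f = (\<lambda>n. dgDiff (T n) (x n) (y n) i (f n))"
  "dgComp (tower_lim T p) x y z i j g f = (\<lambda>n. dgComp (T n) (x n) (y n) (z n) i j (g n) (f n))"
  "dgId (tower_lim T p) x = (\<lambda>n. dgId (T n) (x n))"
  by (simp_all add: tower_lim_def)

definition tower_lim_proj :: "nat \<Rightarrow> ('r, nat \<Rightarrow> 'o, nat \<Rightarrow> 'm) dgcat \<Rightarrow> (nat \<Rightarrow> 'o, nat \<Rightarrow> 'm, 'o, 'm) dgfun" where
  "tower_lim_proj N L = \<lparr>dgfOb = (\<lambda>x. x N), dgfHom = (\<lambda>x y i f. f N)\<rparr>"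

context dg_tower
begin

abbreviation Lim :: "('r, nat \<Rightarrow> 'o, nat \<Rightarrow> 'm) dgcat" where
  "Lim \<equiv> tower_lim T p"

lemma lim_ob: "x \<in> dgOb Lim \<Longrightarrow> x n \<in> dgOb (T n)"
  and lim_ob_compat: "x \<in> dgOb Lim \<Longrightarrow> dgfOb (p n) (x (Suc n)) = x n"
  by (simp_all add: tower_lim_simps)

lemma lim_hom_compat: "f \<in> carrier (dgHom Lim x y i)
    \<Longrightarrow> dgfHom (p n) (x (Suc n)) (y (Suc n)) i (f (Suc n)) = f n"
  by (simp_all add: tower_lim_simps)

lemma transition_hom:
  assumes "x \<in> dgOb Lim" "y \<in> dgOb Lim"
  shows "abelian_group_hom (dgHom (T (Suc n)) (x (Suc n)) (y (Suc n)) i) (dgHom (T n) (x n) (y n) i)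
    (dgfHom (p n) (x (Suc n)) (y (Suc n)) i)"
  using dg_functor.map_hom[OF tower_fun, of "x (Suc n)" n "y (Suc n)" i] assms
  by (simp add: lim_ob lim_ob_compat)

lemma lim_module:
  assumes ob: "x \<in> dgOb Lim" "y \<in> dgOb Lim"
  shows "module R (dgHom Lim x y i)"
proof -
  interpret M: module R "dgHom (T n) (x n) (y n) i" for n
    using dg_category.hom_module[OF tower_cat] ob lim_ob by blast
  interpret p: abelian_group_hom "dgHom (T (Suc n)) (x (Suc n)) (y (Suc n)) i" "dgHom (T n) (x n) (y n) i"
    "dgfHom (p n) (x (Suc n)) (y (Suc n)) i" for n
    using ob by (rule transition_hom)
  have p_smult: "dgfHom (p n) (x (Suc n)) (y (Suc n)) i (a \<odot>\<^bsub>dgHom (T (Suc n)) (x (Suc n)) (y (Suc n)) i\<^esub> f)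
      = a \<odot>\<^bsub>dgHom (T n) (x n) (y n) i\<^esub> dgfHom (p n) (x (Suc n)) (y (Suc n)) i f"
    if "a \<in> carrier R" "f \<in> carrier (dgHom (T (Suc n)) (x (Suc n)) (y (Suc n)) i)" for a f n
    using dg_functor.hom_linear[OF tower_fun, of "x (Suc n)" n "y (Suc n)" i] that ob
    by (simp add: linear_maps_def lim_ob lim_ob_compat)
  show ?thesis
  proof (rule moduleI)
    show "cring R" by (rule M.R.cring_axioms)
    show "abelian_group (dgHom Lim x y i)"
    proof (rule abelian_groupI)
      fix f assume "f \<in> carrier (dgHom Lim x y i)"
      then show "\<exists>g\<in>carrier (dgHom Lim x y i). g \<oplus>\<^bsub>dgHom Lim x y i\<^esub> f = \<zero>\<^bsub>dgHom Lim x y i\<^esub>"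
        by (intro bexI[of _ "\<lambda>n. \<ominus>\<^bsub>dgHom (T n) (x n) (y n) i\<^esub> f n"])
          (simp_all add: tower_lim_simps M.M.l_neg)
    qed (auto simp: tower_lim_simps M.M.a_ac)
  qed (auto simp: tower_lim_simps p_smult M.smult_l_distr M.smult_r_distr M.smult_assoc1)
qed

text \<open>Negation is not a field of the record but derived from addition, so its termwise form
  comes from uniqueness of inverses. The signs in the Leibniz rule depend on it.\<close>

lemma lim_minus:
  assumes ob: "x \<in> dgOb Lim" "y \<in> dgOb Lim" and f: "f \<in> carrier (dgHom Lim x y i)"
  shows "\<ominus>\<^bsub>dgHom Lim x y i\<^esub> f = (\<lambda>n. \<ominus>\<^bsub>dgHom (T n) (x n) (y n) i\<^esub> f n)"
proof -
  interpret M: abelian_group "dgHom (T n) (x n) (y n) i" for n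
    using dg_category.abelian_group_dgHom[OF tower_cat] ob lim_ob by blast
  interpret p: abelian_group_hom "dgHom (T (Suc n)) (x (Suc n)) (y (Suc n)) i" "dgHom (T n) (x n) (y n) i"
    "dgfHom (p n) (x (Suc n)) (y (Suc n)) i" for n
    using ob by (rule transition_hom)
  interpret L: abelian_group "dgHom Lim x y i"
    using lim_module[OF ob] by (rule module.axioms)
  show ?thesis
    using f by (intro L.minus_equality) (simp_all add: tower_lim_simps M.l_neg)
qed

lemma lim_koszul:
  "\<lbrakk>x \<in> dgOb Lim; y \<in> dgOb Lim; f \<in> carrier (dgHom Lim x y i)\<rbrakk>
    \<Longrightarrow> koszul (dgHom Lim x y i) k f = (\<lambda>n. koszul (dgHom (T n) (x n) (y n) i) k (f n))"
  by (simp add: koszul_def lim_minus)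

text \<open>The laws hold termwise; the content is that differentials, composites and identities of
  compatible sequences are compatible again, because the transition maps are dg functors.\<close>

lemma dg_category_lim: "dg_category R Lim"
proof -
  interpret T: dg_category R "T n" for n by (rule tower_cat)
  interpret p: dg_functor R "T (Suc n)" "T n" "p n" for n by (rule tower_fun)
  have comp_closed: "dgComp Lim x y z i j g f \<in> carrier (dgHom Lim x z (i + j))"
    if "x \<in> dgOb Lim" "y \<in> dgOb Lim" "z \<in> dgOb Lim"
      "g \<in> carrier (dgHom Lim y z i)" "f \<in> carrier (dgHom Lim x y j)" for x y z i j f g
    using that p.map_comp[of "x (Suc n)" n "y (Suc n)" "z (Suc n)" "g (Suc n)" i "f (Suc n)" j for n]
    by (simp add: tower_lim_simps T.comp_closed)
  show ?thesis
  proof (intro dg_category.intro dg_category_axioms.intro)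
    show "cring R"
      by (rule T.R.cring_axioms)
  next
    fix x y i assume ob: "x \<in> dgOb Lim" "y \<in> dgOb Lim"
    show "module R (dgHom Lim x y i)"
      using ob by (rule lim_module)
    have "dgDiff Lim x y i f \<in> carrier (dgHom Lim x y (i - 1))" if "f \<in> carrier (dgHom Lim x y i)" for f
      using that ob p.map_diff[of "x (Suc n)" n "y (Suc n)" "f (Suc n)" i for n]
      by (simp add: tower_lim_simps T.diff_closed)
    then show "dgDiff Lim x y i \<in> linear_maps R (dgHom Lim x y i) (dgHom Lim x y (i - 1))"
      using T.diff_linear[of "x n" n "y n" i for n] ob
      by (simp add: linear_maps_def) (simp add: tower_lim_simps)
  next
    fix x y f i assume "x \<in> dgOb Lim" "y \<in> dgOb Lim" "f \<in> carrier (dgHom Lim x y i)"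
    then show "dgDiff Lim x y (i - 1) (dgDiff Lim x y i f) = \<zero>\<^bsub>dgHom Lim x y (i - 1 - 1)\<^esub>"
      by (simp add: tower_lim_simps T.diff_diff)
  next
    fix x y z g i j
    assume "x \<in> dgOb Lim" "y \<in> dgOb Lim" "z \<in> dgOb Lim" "g \<in> carrier (dgHom Lim y z i)"
    then show "dgComp Lim x y z i j g \<in> linear_maps R (dgHom Lim x y j) (dgHom Lim x z (i + j))"
      using comp_closed T.comp_linear_right[of "x n" n "y n" "z n" "g n" i j for n]
      by (simp add: linear_maps_def) (simp add: tower_lim_simps)
  next
    fix x y z f i j
    assume "x \<in> dgOb Lim" "y \<in> dgOb Lim" "z \<in> dgOb Lim" "f \<in> carrier (dgHom Lim x y j)"
    then show "(\<lambda>g. dgComp Lim x y z i j g f) \<in> linear_maps R (dgHom Lim y z i) (dgHom Lim x z (i + j))"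
      using comp_closed T.comp_linear_left[of "x n" n "y n" "z n" "f n" j i for n]
      by (simp add: linear_maps_def) (simp add: tower_lim_simps)
  next
    fix x y z g i f j
    assume ob: "x \<in> dgOb Lim" "y \<in> dgOb Lim" "z \<in> dgOb Lim"
      and gf: "g \<in> carrier (dgHom Lim y z i)" "f \<in> carrier (dgHom Lim x y j)"
    have "dgDiff Lim x y j f \<in> carrier (dgHom Lim x y (j - 1))"
      using ob gf p.map_diff[of "x (Suc n)" n "y (Suc n)" "f (Suc n)" j for n]
      by (simp add: tower_lim_simps T.diff_closed)
    then have "dgComp Lim x y z i (j - 1) g (dgDiff Lim x y j f) \<in> carrier (dgHom Lim x z (i + j - 1))"
      using comp_closed[OF ob gf(1), of _ "j - 1"] by (simp add: algebra_simps)
    \<comment> \<open>The sign is distributed over the sequence while membership in the limit is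
      still visible; only then is the limit unfolded.\<close>
    then show "dgDiff Lim x z (i + j) (dgComp Lim x y z i j g f) =
        dgComp Lim x y z (i - 1) j (dgDiff Lim y z i g) f \<oplus>\<^bsub>dgHom Lim x z (i + j - 1)\<^esub>
        koszul (dgHom Lim x z (i + j - 1)) i (dgComp Lim x y z i (j - 1) g (dgDiff Lim x y j f))"
      using ob gf by (simp add: lim_koszul) (simp add: tower_lim_simps T.leibniz)
  next
    fix w x y z h i g j f k
    assume "w \<in> dgOb Lim" "x \<in> dgOb Lim" "y \<in> dgOb Lim" "z \<in> dgOb Lim" "h \<in> carrier (dgHom Lim y z i)"
        "g \<in> carrier (dgHom Lim x y j)" "f \<in> carrier (dgHom Lim w x k)"
    then show "dgComp Lim w x z (i + j) k (dgComp Lim x y z i j h g) f =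
          dgComp Lim w y z i (j + k) h (dgComp Lim w x y j k g f)"
      using T.comp_assoc[of "w n" n "x n" "y n" "z n" "h n" i "g n" j "f n" k for n]
      by (simp add: tower_lim_simps)
  next
    fix x assume "x \<in> dgOb Lim"
    then show "dgId Lim x \<in> carrier (dgHom Lim x x 0)"
      using p.map_id[of "x (Suc n)" n for n] by (simp add: tower_lim_simps T.id_closed)
  qed (simp_all add: tower_lim_simps T.id_cycle T.id_left T.id_right)
qed

lemma dg_functor_proj: "dg_functor R Lim (T N) (tower_lim_proj N Lim)"
proof -
  interpret L: dg_category R Lim by (rule dg_category_lim)
  interpret T: dg_category R "T N" by (rule tower_cat)
  show ?thesis
    by unfold_locales (auto simp: tower_lim_proj_def tower_lim_simps linear_maps_def)
qed

lemma dg_functor_tower_lim_fun: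
  assumes A: "dg_category R A" and P: "\<And>n. dg_functor R A (T n) (P n)"
    and compat: "\<And>n. dgfun_eq_on A (dgfun_comp (p n) (P (Suc n))) (P n)"
  shows "dg_functor R A Lim (tower_lim_fun P)"
proof -
  interpret L: dg_category R Lim by (rule dg_category_lim)
  interpret A: dg_category R A by (rule A)
  interpret P: dg_functor R A "T n" "P n" for n by (rule P)
  have ob_compat: "dgfOb (p n) (dgfOb (P (Suc n)) x) = dgfOb (P n) x" if "x \<in> dgOb A" for x n
    using compat[of n] that by (simp add: dgfun_eq_on_def dgfun_comp_def)
  have hom_compat: "dgfHom (p n) (dgfOb (P (Suc n)) x) (dgfOb (P (Suc n)) y) i (dgfHom (P (Suc n)) x y i f)
      = dgfHom (P n) x y i f" if "x \<in> dgOb A" "y \<in> dgOb A" "f \<in> carrier (dgHom A x y i)" for x y i f n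
    using compat[of n] that by (simp add: dgfun_eq_on_def dgfun_comp_def)
  show ?thesis
  proof
    fix x y i assume "x \<in> dgOb A" "y \<in> dgOb A"
    then show "dgfHom (tower_lim_fun P) x y i \<in> linear_maps R (dgHom A x y i)
        (dgHom Lim (dgfOb (tower_lim_fun P) x) (dgfOb (tower_lim_fun P) y) i)"
      using P.hom_linear[of x y n i for n] hom_compat P.map_closed
      by (auto simp: linear_maps_def tower_lim_fun_def tower_lim_simps)
  qed (simp_all add: tower_lim_fun_def tower_lim_simps P.ob_closed P.map_diff P.map_id P.map_comp ob_compat)
qed

text \<open>The transition maps compute each component from the next one, so the components from
  stage \<open>N\<close> on determine the rest. Equations need checking only where homology is under
  control.\<close>

lemma lim_hom_eqI:
  assumes "f \<in> carrier (dgHom Lim x y i)" "g \<in> carrier (dgHom Lim x y i)"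
    and eq: "\<And>n. N \<le> n \<Longrightarrow> f n = g n"
  shows "f = g"
proof
  fix n
  show "f n = g n"
  proof (cases "n \<le> N")
    case True
    then show ?thesis
    proof (induction rule: inc_induct)
      case (step m)
      then show ?case
        using lim_hom_compat[OF assms(1), of m] lim_hom_compat[OF assms(2), of m] by simp
    qed (simp add: eq)
  qed (simp add: eq)
qed

text \<open>Above \<open>N\<close> the sequence is built by dependent choice, with \<open>Q\<close>
  as the invariant that makes the next lift possible; below \<open>N\<close> the components are
  forced, namely the images of \<open>h\<close>.\<close>

lemma lim_extend:
  assumes ob: "x \<in> dgOb Lim" "y \<in> dgOb Lim"
    and h: "h \<in> carrier (dgHom (T N) (x N) (y N) i)" "Q N h"
    and step: "\<And>n g. \<lbrakk>N \<le> n; g \<in> carrier (dgHom (T n) (x n) (y n) i); Q n g\<rbrakk> \<Longrightarrow>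
      \<exists>g' \<in> carrier (dgHom (T (Suc n)) (x (Suc n)) (y (Suc n)) i).
        dgfHom (p n) (x (Suc n)) (y (Suc n)) i g' = g \<and> Q (Suc n) g'"
  obtains f where "f \<in> carrier (dgHom Lim x y i)" "f N = h" "\<And>n. N \<le> n \<Longrightarrow> Q n (f n)"
proof -
  let ?H = "\<lambda>n. carrier (dgHom (T n) (x n) (y n) i)"
  let ?p = "\<lambda>n. dgfHom (p n) (x (Suc n)) (y (Suc n)) i"
  \<comment> \<open>The clause for \<open>k = 0\<close> pins the start of the choice to
    \<open>h\<close>.\<close>
  have "\<exists>g. \<forall>k. (g k \<in> ?H (N + k) \<and> Q (N + k) (g k) \<and> (k = 0 \<longrightarrow> g k = h)) \<and> ?p (N + k) (g (Suc k)) = g k"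
  proof (rule dependent_nat_choice)
    fix g k assume "g \<in> ?H (N + k) \<and> Q (N + k) g \<and> (k = 0 \<longrightarrow> g = h)"
    then show "\<exists>g'. (g' \<in> ?H (N + Suc k) \<and> Q (N + Suc k) g' \<and> (Suc k = 0 \<longrightarrow> g' = h)) \<and> ?p (N + k) g' = g"
      using step[of "N + k" g] by auto
  qed (use h in auto)
  then obtain g where g: "\<And>k. g k \<in> ?H (N + k)" "\<And>k. Q (N + k) (g k)" "g 0 = h"
      "\<And>k. ?p (N + k) (g (Suc k)) = g k"
    by blast
  \<comment> \<open>For \<open>k \<le> N\<close>, \<open>d k\<close> is the image of
    \<open>h\<close> at stage \<open>N - k\<close>.\<close>
  define d where "d = rec_nat h (\<lambda>k e. ?p (N - Suc k) e)"
  have d: "d 0 = h" "d (Suc k) = ?p (N - Suc k) (d k)" for k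
    by (simp_all add: d_def)
  have d_hom: "d k \<in> ?H (N - k)" if "k \<le> N" for k
    using that
  proof (induction k)
    case (Suc k)
    then have "Suc (N - Suc k) = N - k" by simp
    then show ?case
      using Suc abelian_group_hom.hom_closed[OF transition_hom[OF ob], of "d k" "N - Suc k" i] by (simp add: d)
  qed (simp add: d h)
  define f where "f n = (if n < N then d (N - n) else g (n - N))" for n
  show thesis
  proof
    have "f n \<in> ?H n" for n
      using d_hom[of "N - n"] g(1)[of "n - N"] by (cases "n < N") (simp_all add: f_def)
    moreover have "?p n (f (Suc n)) = f n" for n
    proof -
      \<comment> \<open>The two halves meet at \<open>Suc n = N\<close>, where the chosen sequence
        starts with \<open>h\<close> and \<open>d\<close> makes its first step.\<close>
      consider "Suc n < N" | "Suc n = N" | "N \<le> n" by linarith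
      then show ?thesis
      proof cases
        case 1
        then have "N - n = Suc (N - Suc n)" "N - Suc (N - Suc n) = n" by simp_all
        then show ?thesis using 1 d(2)[of "N - Suc n"] by (simp add: f_def)
      next
        case 2
        then have "N - n = Suc 0" "n = N - Suc 0" by simp_all
        then show ?thesis using 2 d(2)[of 0] d(1) g(3) by (simp add: f_def)
      next
        case 3
        then show ?thesis using g(4)[of "n - N"] by (simp add: f_def Suc_diff_le)
      qed
    qed
    ultimately show "f \<in> carrier (dgHom Lim x y i)"
      by (simp add: tower_lim_simps)
    show "f N = h" by (simp add: f_def g)
    show "Q n (f n)" if "N \<le> n" for n
      using g(2)[of "n - N"] that by (simp add: f_def)
  qed
qed

section \<open>Homology of the projections from the limit\<close>

lemma lim_cycles: "f \<in> cycles Lim x y i \<Longrightarrow> f n \<in> cycles (T n) (x n) (y n) i"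
  by (auto simp: cycles_def tower_lim_simps dest: fun_cong)

text \<open>Milnor's exact sequence in a stable range: if the transition maps are surjective and induce
  isomorphisms on homology in degrees up to \<open>n\<close> at stage \<open>n\<close>, no derived limit occurs.\<close>

lemma homology_iso_proj:
  assumes surj: "\<And>n a b k. \<lbrakk>a \<in> dgOb (T (Suc n)); b \<in> dgOb (T (Suc n))\<rbrakk> \<Longrightarrow>
      dgfHom (p n) a b k ` carrier (dgHom (T (Suc n)) a b k)
      = carrier (dgHom (T n) (dgfOb (p n) a) (dgfOb (p n) b) k)"
    and iso: "\<And>n a b k. \<lbrakk>a \<in> dgOb (T (Suc n)); b \<in> dgOb (T (Suc n)); k \<le> int n\<rbrakk> \<Longrightarrow>
      homology_iso (T (Suc n)) (T n) (p n) a b k"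
    and ob: "x \<in> dgOb Lim" "y \<in> dgOb Lim" and N: "i + 1 \<le> int N"
  shows "homology_iso Lim (T N) (tower_lim_proj N Lim) x y i"
proof -
  interpret L: dg_category R Lim by (rule dg_category_lim)
  interpret T: dg_category R "T n" for n by (rule tower_cat)
  interpret p: dg_functor R "T (Suc n)" "T n" "p n" for n by (rule tower_fun)
  interpret ev: dg_functor R Lim "T N" "tower_lim_proj N Lim" by (rule dg_functor_proj)
  have ob_n: "x n \<in> dgOb (T n)" "y n \<in> dgOb (T n)" for n
    using ob lim_ob by blast+
  have compat: "dgfOb (p n) (x (Suc n)) = x n" "dgfOb (p n) (y (Suc n)) = y n" for n
    using ob lim_ob_compat by blast+
  have inj_n: "homology_injective (T (Suc n)) (T n) (p n) (x (Suc n)) (y (Suc n)) k"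
    and surj_n: "homology_surjective (T (Suc n)) (T n) (p n) (x (Suc n)) (y (Suc n)) k"
    if "k \<le> int n" for n k
    using iso[OF ob_n that] p.homology_iso_iff[OF ob_n] by auto
  have "homology_surjective Lim (T N) (tower_lim_proj N Lim) x y i"
    unfolding homology_surjective_def
  proof
    fix g assume "g \<in> cycles (T N) (dgfOb (tower_lim_proj N Lim) x) (dgfOb (tower_lim_proj N Lim) y) i"
    then have g: "g \<in> cycles (T N) (x N) (y N) i"
      by (simp add: tower_lim_proj_def)
    \<comment> \<open>The invariant is being a cycle: at the stages \<open>n \<ge> N > i\<close>
      every cycle of degree \<open>i\<close> lifts strictly along \<open>p n\<close>.\<close>
    obtain f where f: "f \<in> carrier (dgHom Lim x y i)" "f N = g"
      and cyc: "\<And>n. N \<le> n \<Longrightarrow> f n \<in> cycles (T n) (x n) (y n) i"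
    proof (rule lim_extend[OF ob])
      show "g \<in> carrier (dgHom (T N) (x N) (y N) i)"
        using g by (simp add: cycles_def)
      show "g \<in> cycles (T N) (x N) (y N) i" by fact
      fix n h assume "N \<le> n" "h \<in> cycles (T n) (x n) (y n) i"
      then obtain h' where "h' \<in> cycles (T (Suc n)) (x (Suc n)) (y (Suc n)) i"
          "dgfHom (p n) (x (Suc n)) (y (Suc n)) i h' = h"
        using p.lift_cycle[OF ob_n surj[OF ob_n] surj_n, of i n h] N by (auto simp: compat)
      then show "\<exists>h'\<in>carrier (dgHom (T (Suc n)) (x (Suc n)) (y (Suc n)) i).
          dgfHom (p n) (x (Suc n)) (y (Suc n)) i h' = h \<and> h' \<in> cycles (T (Suc n)) (x (Suc n)) (y (Suc n)) i"
        by (auto simp: cycles_def)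
    qed blast
    \<comment> \<open>The lifting controls the components from \<open>N\<close> on; those below
      follow by compatibility.\<close>
    have "dgDiff Lim x y i f = \<zero>\<^bsub>dgHom Lim x y (i - 1)\<^esub>"
    proof (rule lim_hom_eqI)
      show "dgDiff Lim x y i f \<in> carrier (dgHom Lim x y (i - 1))"
        using ob f(1) by (rule L.diff_closed)
      show "\<zero>\<^bsub>dgHom Lim x y (i - 1)\<^esub> \<in> carrier (dgHom Lim x y (i - 1))"
        using L.abelian_group_dgHom[OF ob] by (simp add: abelian_group_def abelian_monoid.zero_closed)
      show "dgDiff Lim x y i f n = \<zero>\<^bsub>dgHom Lim x y (i - 1)\<^esub> n" if "N \<le> n" for n
        using cyc[OF that] by (simp add: tower_lim_simps cycles_def)
    qed
    then have "f \<in> cycles Lim x y i"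
      using f(1) by (simp add: cycles_def)
    then show "\<exists>f\<in>cycles Lim x y i. homologous (T N) (dgfOb (tower_lim_proj N Lim) x)
        (dgfOb (tower_lim_proj N Lim) y) i (dgfHom (tower_lim_proj N Lim) x y i f) g"
      using f(2) g T.homologous_refl by (intro bexI[of _ f]) (simp_all add: tower_lim_proj_def)
  qed
  moreover have "homology_injective Lim (T N) (tower_lim_proj N Lim) x y i"
    unfolding homology_injective_def
  proof (intro ballI impI)
    fix f g assume fg: "f \<in> cycles Lim x y i" "g \<in> cycles Lim x y i"
      and hom: "homologous (T N) (dgfOb (tower_lim_proj N Lim) x) (dgfOb (tower_lim_proj N Lim) y) i
        (dgfHom (tower_lim_proj N Lim) x y i f) (dgfHom (tower_lim_proj N Lim) x y i g)"
    \<comment> \<open>For the difference, the claim is that a bounding chain at stage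
      \<open>N\<close> extends to one in the limit.\<close>
    define k where "k = f \<ominus>\<^bsub>dgHom Lim x y i\<^esub> g"
    interpret Z: additive_subgroup "cycles Lim x y i" "dgHom Lim x y i"
      using ob by (rule L.cycles_subgroup)
    have k: "k \<in> cycles Lim x y i"
      unfolding k_def a_minus_def
      using fg L.abelian_group_dgHom[OF ob] by (intro Z.a_closed Z.a_inv_closed) auto
    have k_hom: "k \<in> carrier (dgHom Lim x y i)"
      using k by (rule L.cycles_carrier)
    have "k N = f N \<ominus>\<^bsub>dgHom (T N) (x N) (y N) i\<^esub> g N"
      using L.cycles_carrier[OF fg(2)] ob by (simp add: k_def a_minus_def lim_minus) (simp add: tower_lim_simps)
    then have "homologous (T N) (x N) (y N) i (k N) \<zero>\<^bsub>dgHom (T N) (x N) (y N) i\<^esub>"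
      using hom T.homologous_minus_iff[OF ob_n lim_cycles[OF fg(1)] lim_cycles[OF fg(2)]]
      by (simp add: tower_lim_proj_def)
    then obtain h0 where h0: "h0 \<in> carrier (dgHom (T N) (x N) (y N) (i + 1))"
        "dgDiff (T N) (x N) (y N) (i + 1) h0 = k N"
      using T.homologous_zero_iff[OF ob_n] by auto
    \<comment> \<open>The invariant is now that \<open>h n\<close> bounds \<open>k n\<close>.
      Lifting it along \<open>p n\<close> uses surjectivity on homology in degree
      \<open>i + 1\<close>, which \<open>i + 1 \<le> N\<close> provides at all
      \<open>n \<ge> N\<close>.\<close>
    obtain h where h: "h \<in> carrier (dgHom Lim x y (i + 1))"
      and dh: "\<And>n. N \<le> n \<Longrightarrow> dgDiff (T n) (x n) (y n) (i + 1) (h n) = k n"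
    proof (rule lim_extend[OF ob])
      show "h0 \<in> carrier (dgHom (T N) (x N) (y N) (i + 1))"
        "dgDiff (T N) (x N) (y N) (i + 1) h0 = k N" by fact+
      fix n e
      assume n: "N \<le> n" and e: "e \<in> carrier (dgHom (T n) (x n) (y n) (i + 1))"
        "dgDiff (T n) (x n) (y n) (i + 1) e = k n"
      have kn: "dgfHom (p n) (x (Suc n)) (y (Suc n)) i (k (Suc n)) = k n"
        using k_hom by (rule lim_hom_compat)
      obtain e' where "e' \<in> carrier (dgHom (T (Suc n)) (x (Suc n)) (y (Suc n)) (i + 1))"
          "dgfHom (p n) (x (Suc n)) (y (Suc n)) (i + 1) e' = e"
          "dgDiff (T (Suc n)) (x (Suc n)) (y (Suc n)) (i + 1) e' = k (Suc n)"
        using p.lift_boundary[OF ob_n surj[OF ob_n] inj_n surj_n lim_cycles[OF k], of n e] e N n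
        by (auto simp: compat kn)
      then show "\<exists>e'\<in>carrier (dgHom (T (Suc n)) (x (Suc n)) (y (Suc n)) (i + 1)).
          dgfHom (p n) (x (Suc n)) (y (Suc n)) (i + 1) e' = e \<and>
          dgDiff (T (Suc n)) (x (Suc n)) (y (Suc n)) (i + 1) e' = k (Suc n)"
        by blast
    qed blast
    have "dgDiff Lim x y (i + 1) h = k"
      using L.diff_succ_closed[OF ob h] k_hom
    proof (rule lim_hom_eqI)
      show "dgDiff Lim x y (i + 1) h n = k n" if "N \<le> n" for n
        using dh[OF that] by (simp add: tower_lim_simps)
    qed
    then have "homologous Lim x y i k \<zero>\<^bsub>dgHom Lim x y i\<^esub>"
      using L.homologous_zero_iff[OF ob] h by blast
    then show "homologous Lim x y i f g"
      using L.homologous_minus_iff[OF ob fg] by (simp add: k_def)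
  qed
  ultimately show ?thesis
    using ev.homology_iso_iff[OF ob] by simp
qed

end

section \<open>Postnikov towers\<close>

lemma homology_injective_cong:
  assumes "dgfun_eq_on A F G" "x \<in> dgOb A" "y \<in> dgOb A"
  shows "homology_injective A B F x y i \<longleftrightarrow> homology_injective A B G x y i"
proof -
  have "dgfOb F x = dgfOb G x" "dgfOb F y = dgfOb G y"
    "f \<in> cycles A x y i \<Longrightarrow> dgfHom F x y i f = dgfHom G x y i f" for f
    using assms by (simp_all add: dgfun_eq_on_def cycles_def)
  then show ?thesis
    by (simp add: homology_injective_def)
qed

lemma homology_surjective_cong:
  assumes "dgfun_eq_on A F G" "x \<in> dgOb A" "y \<in> dgOb A"
  shows "homology_surjective A B F x y i \<longleftrightarrow> homology_surjective A B G x y i"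
proof -
  have "dgfOb F x = dgfOb G x" "dgfOb F y = dgfOb G y"
    "f \<in> cycles A x y i \<Longrightarrow> dgfHom F x y i f = dgfHom G x y i f" for f
    using assms by (simp_all add: dgfun_eq_on_def cycles_def)
  then show ?thesis
    by (simp add: homology_surjective_def)
qed

lemma dgfun_comp_proj: "dgfun_comp (tower_lim_proj N L) (tower_lim_fun P) = P N"
  by (simp add: dgfun_comp_def tower_lim_proj_def tower_lim_fun_def)

text \<open>Transporting along isomorphisms in \<open>H0\<close> to the essential image of \<open>F\<close>, two out of three
  gives a statement about all objects of \<open>B\<close>.\<close>

lemma homology_iso_if_ess_surj:
  assumes F: "dg_functor R A B F" and G: "dg_functor R B C G"
    and comp: "dgfun_eq_on A (dgfun_comp G F) H"
    and H: "dg_functor R A C H"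
    and F_iso: "\<And>x y. \<lbrakk>x \<in> dgOb A; y \<in> dgOb A\<rbrakk> \<Longrightarrow> homology_iso A B F x y i"
    and H_iso: "\<And>x y. \<lbrakk>x \<in> dgOb A; y \<in> dgOb A\<rbrakk> \<Longrightarrow> homology_iso A C H x y i"
    and ess: "H0_ess_surj A B F"
    and ob: "a \<in> dgOb B" "b \<in> dgOb B"
  shows "homology_iso B C G a b i"
proof -
  interpret F: dg_functor R A B F by fact
  interpret G: dg_functor R B C G by fact
  interpret H: dg_functor R A C H by fact
  obtain x u where x: "x \<in> dgOb A" and u: "H0_invertible B (dgfOb F x) a u"
    using ess ob unfolding H0_ess_surj_def by blast
  obtain y v where y: "y \<in> dgOb A" and v: "H0_invertible B (dgfOb F y) b v"
    using ess ob unfolding H0_ess_surj_def by blast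
  note transport_ob = x[THEN F.ob_closed] y[THEN F.ob_closed] ob
  have F_xy: "homology_surjective A B F x y i"
    using F_iso[OF x y] F.homology_iso_iff[OF x y] by blast
  have H_xy: "homology_injective A C (dgfun_comp G F) x y i" "homology_surjective A C (dgfun_comp G F) x y i"
    using H_iso[OF x y] H.homology_iso_iff[OF x y]
      homology_injective_cong[OF comp x y] homology_surjective_cong[OF comp x y] by blast+
  have "homology_injective B C G a b i"
    using homology_injective_cancel_right[OF F G x y H_xy(1) F_xy]
    by (rule G.homology_injective_transport[OF transport_ob u v])
  moreover have "homology_surjective B C G a b i"
    using homology_surjective_compD[OF F x y H_xy(2)]
    by (rule G.homology_surjective_transport[OF transport_ob u v])
  ultimately show ?thesis
    using G.homology_iso_iff[OF ob] by blast
qed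

text \<open>Stated for arbitrary functors \<open>Q n\<close> with the homological properties of a
  Postnikov tower, so that truncation and fibrant replacement enter only when it is applied.\<close>

lemma (in dg_tower) quasi_equivalence_lim:
  assumes surj: "\<And>n a b k. \<lbrakk>a \<in> dgOb (T (Suc n)); b \<in> dgOb (T (Suc n))\<rbrakk> \<Longrightarrow>
      dgfHom (p n) a b k ` carrier (dgHom (T (Suc n)) a b k)
      = carrier (dgHom (T n) (dgfOb (p n) a) (dgfOb (p n) b) k)"
    and Q: "\<And>n. dg_functor R A (T n) (Q n)"
    and compat: "\<And>n. dgfun_eq_on A (dgfun_comp (p n) (Q (Suc n))) (Q n)"
    and iso: "\<And>n x y i. \<lbrakk>x \<in> dgOb A; y \<in> dgOb A; i \<le> int n\<rbrakk> \<Longrightarrow> homology_iso A (T n) (Q n) x y i"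
    and ess: "\<And>n. H0_ess_surj A (T n) (Q n)"
  shows "quasi_equivalence R A Lim (tower_lim_fun Q)"
proof -
  have A: "dg_category R A"
    using Q dg_functor_def by blast
  interpret F: dg_functor R A Lim "tower_lim_fun Q"
    using A Q compat by (rule dg_functor_tower_lim_fun)
  interpret Q: dg_functor R A "T n" "Q n" for n by (rule Q)
  interpret proj: dg_functor R Lim "T n" "tower_lim_proj n Lim" for n by (rule dg_functor_proj)
  \<comment> \<open>\<open>Q n\<close> sets the bound \<open>k \<le> n\<close>;
    \<open>Q (Suc n)\<close> is an isomorphism on homology one degree further.\<close>
  have p_iso: "homology_iso (T (Suc n)) (T n) (p n) a b k"
    if "a \<in> dgOb (T (Suc n))" "b \<in> dgOb (T (Suc n))" "k \<le> int n" for n a b k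
    using that(3) iso by (intro homology_iso_if_ess_surj[OF Q tower_fun compat Q _ _ ess that(1,2)]) auto
  have proj_iso: "homology_iso Lim (T n) (tower_lim_proj n Lim) x y i"
    if "x \<in> dgOb Lim" "y \<in> dgOb Lim" "i + 1 \<le> int n" for n x y i
    using surj p_iso that by (rule homology_iso_proj)
  show ?thesis
  proof (rule F.quasi_equivalenceI)
    fix x y i assume ob: "x \<in> dgOb A" "y \<in> dgOb A"
    \<comment> \<open>The least stage with \<open>i + 1 \<le> n\<close>, which is stage 0 for
      negative \<open>i\<close>.\<close>
    define n where "n = nat (i + 1)"
    have n: "i + 1 \<le> int n" "i \<le> int n"
      by (simp_all add: n_def)
    note Fob = ob[THEN F.ob_closed]
    have Qn: "homology_injective A (T n) (dgfun_comp (tower_lim_proj n Lim) (tower_lim_fun Q)) x y i"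
      "homology_surjective A (T n) (dgfun_comp (tower_lim_proj n Lim) (tower_lim_fun Q)) x y i"
      using iso[OF ob n(2)] Q.homology_iso_iff[OF ob] by (simp_all add: dgfun_comp_proj)
    have "homology_injective Lim (T n) (tower_lim_proj n Lim)
        (dgfOb (tower_lim_fun Q) x) (dgfOb (tower_lim_fun Q) y) i"
      using proj_iso[OF Fob n(1)] proj.homology_iso_iff[OF Fob] by blast
    then have "homology_surjective A Lim (tower_lim_fun Q) x y i"
      by (rule homology_surjective_cancel_left[OF F.dg_functor_axioms ob dg_functor_proj Qn(2)])
    then show "homology_iso A Lim (tower_lim_fun Q) x y i"
      using homology_injective_compD[OF F.dg_functor_axioms dg_functor_proj ob Qn(1)]
        F.homology_iso_iff[OF ob] by blast
  next
    \<comment> \<open>Stage 1 is the first whose projection \<open>proj_iso\<close> covers in degree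
      0, since it asks for \<open>0 + 1 \<le> n\<close>.\<close>
    have "H0_ess_surj A (T 1) (dgfun_comp (tower_lim_proj 1 Lim) (tower_lim_fun Q))"
      using ess by (simp add: dgfun_comp_proj)
    then show "H0_ess_surj A Lim (tower_lim_fun Q)"
      using proj_iso by (intro H0_ess_surj_cancel_left[OF F.dg_functor_axioms dg_functor_proj[of 1]]) auto
  qed
qed

theorem proposition4p19:
  fixes R :: "('r, 's) ring_scheme"
    and A :: "('r, 'o, 'm) dgcat"
    and T :: "nat \<Rightarrow> ('r, 'p, 'n) dgcat"
    and p :: "nat \<Rightarrow> ('p, 'n, 'p, 'n) dgfun"
    and P :: "nat \<Rightarrow> ('o, 'm, 'p, 'n) dgfun"
    and T' :: "nat \<Rightarrow> ('r, 'q, 'k) dgcat"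
    and p' :: "nat \<Rightarrow> ('q, 'k, 'q, 'k) dgfun"
    and \<eta> :: "nat \<Rightarrow> ('p, 'n, 'q, 'k) dgfun"
  assumes "cring R"
    and "dg_category R A"
    and "homologically_connective A"
    and "postnikov_tower R (truncation A) T p P"
    and "fibrant_replacement R T p T' p' \<eta>"
  shows "quasi_equivalence R (truncation A) (tower_lim T' p')
    (tower_lim_fun (\<lambda>n. dgfun_comp (\<eta> n) (P n)))"
proof -
  let ?B = "truncation A"
  have P: "dg_functor R ?B (T n) (P n)"
    and pP: "dgfun_eq_on ?B (dgfun_comp (p n) (P (Suc n))) (P n)"
    and P_iso: "\<lbrakk>x \<in> dgOb ?B; y \<in> dgOb ?B; i \<le> int n\<rbrakk> \<Longrightarrow> homology_iso ?B (T n) (P n) x y i"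
    and P_equiv: "cat_equivalence (H0 ?B) (H0 (T n)) (H0_fun (T n) (P n))" for n x y i
    using assms(4) unfolding postnikov_tower_def by blast+
  have tower: "dg_tower R T' p'"
    and \<eta>_qe: "quasi_equivalence R (T n) (T' n) (\<eta> n)"
    and p\<eta>: "dgfun_eq_on (T (Suc n)) (dgfun_comp (p' n) (\<eta> (Suc n))) (dgfun_comp (\<eta> n) (p n))"
    and fib: "dg_fibration R (T' (Suc n)) (T' n) (p' n)" for n
    using assms(5) unfolding fibrant_replacement_def by blast+
  have \<eta>: "dg_functor R (T n) (T' n) (\<eta> n)"
    and \<eta>_iso: "\<lbrakk>a \<in> dgOb (T n); b \<in> dgOb (T n)\<rbrakk> \<Longrightarrow> homology_iso (T n) (T' n) (\<eta> n) a b i"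
    and \<eta>_equiv: "cat_equivalence (H0 (T n)) (H0 (T' n)) (H0_fun (T' n) (\<eta> n))" for n a b i
    using \<eta>_qe unfolding quasi_equivalence_def by blast+
  interpret P: dg_functor R ?B "T n" "P n" for n by (rule P)
  interpret \<eta>: dg_functor R "T n" "T' n" "\<eta> n" for n by (rule \<eta>)
  let ?Q = "\<lambda>n. dgfun_comp (\<eta> n) (P n)"
  have Q: "dg_functor R ?B (T' n) (?Q n)" for n
    using P \<eta> by (rule dg_functor_comp)
  show ?thesis
  proof (rule dg_tower.quasi_equivalence_lim[OF tower _ Q])
    fix n
    show "dgfHom (p' n) a b k ` carrier (dgHom (T' (Suc n)) a b k)
        = carrier (dgHom (T' n) (dgfOb (p' n) a) (dgfOb (p' n) b) k)"
      if "a \<in> dgOb (T' (Suc n))" "b \<in> dgOb (T' (Suc n))" for a b k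
      using fib that unfolding dg_fibration_def by blast
    \<comment> \<open>The chain is \<open>p' \<eta> P = \<eta> p P = \<eta> P\<close>. The
      naturality of \<open>\<eta>\<close> speaks only of objects and carriers of
      \<open>T (Suc n)\<close>, hence the closure facts for \<open>P (Suc n)\<close>.\<close>
    show "dgfun_eq_on ?B (dgfun_comp (p' n) (?Q (Suc n))) (?Q n)"
      using pP[of n] p\<eta>[of n] P.ob_closed[of _ "Suc n"] P.map_closed[of _ _ _ _ "Suc n"]
      by (simp add: dgfun_eq_on_def dgfun_comp_def)
    \<comment> \<open>\<open>\<eta> n\<close> is an isomorphism on homology in every degree, so the
      range \<open>i \<le> n\<close> of \<open>P n\<close> carries over to the composite.\<close>
    show "homology_iso ?B (T' n) (?Q n) x y i"
      if ob: "x \<in> dgOb ?B" "y \<in> dgOb ?B" and i: "i \<le> int n" for x y i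
    proof -
      have "homology_injective ?B (T n) (P n) x y i" "homology_surjective ?B (T n) (P n) x y i"
        using P_iso[OF ob i] P.homology_iso_iff[OF ob] by auto
      moreover have "homology_injective (T n) (T' n) (\<eta> n) (dgfOb (P n) x) (dgfOb (P n) y) i"
        "homology_surjective (T n) (T' n) (\<eta> n) (dgfOb (P n) x) (dgfOb (P n) y) i"
        using \<eta>_iso \<eta>.homology_iso_iff ob[THEN P.ob_closed] by blast+
      ultimately show ?thesis
        using dg_functor.homology_iso_iff[OF Q ob] homology_injective_comp[OF P ob]
          homology_surjective_comp[OF P \<eta> ob] by blast
    qed
    show "H0_ess_surj ?B (T' n) (?Q n)"
      using P.H0_ess_surj_if_equivalence[OF P_equiv] \<eta>.H0_ess_surj_if_equivalence[OF \<eta>_equiv]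
      by (rule H0_ess_surj_comp[OF P \<eta>])
  qed
qed

end
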